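(* For any even positive integer $p$, there exists a polynomial-time many-one (Karp) reduction from $(0,1)$-$\mathrm{CVP}_p$ on lattices of rank $n$ to Weighted Max-$p$-SAT on $n$ variables.
   Context: $\|\vec v\|_p=(\sum_i |v[i]|^p)^{1/p}$. $(0,1)$-$\mathrm{CVP}_p$: given a basis $\mathbf{B}\in\mathbb{Z}^{m\times n}$ (linearly independent columns; $n$ is the rank), a target $\vec t\in\mathbb{Z}^m$ and $d>0$, distinguish YES instances (some $\vec z\in\{0,1\}^n$ has $\|\mathbf{B}\vec z-\vec t\|_p\le d$) from NO instances ($\|\mathbf{B}\vec z-\vec t\|_p>d$ for all $\vec z\in\{0,1\}^n$). A $k$-SAT formula on Boolean variables $x_1,\dots,x_n$ is a conjunction of clauses, each a disjunction of at most $k$ literals (variables or their negations). Weighted Max-$k$-SAT: given a $k$-SAT formula with clauses $C_1,\dots,C_m$ on $n$ variables, a clause weight function $w$, and a number $d$, distinguish YES instances, where some assignment has total weight of satisfied clauses at least $d$, from NO instances, where every assignment has total weight of satisfied clauses less than $d$. A Karp reduction is a polynomial-time map from instances of one problem to instances of the other sending YES instances to YES instances and NO instances to NO instances. *)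

theory Defs
  imports
    Complex_Main
    "HOL-Computational_Algebra.Polynomial"
    "HOL-Library.Log_Nat"
    "Jordan_Normal_Form.Matrix"
    "Jordan_Normal_Form.VS_Connect"
begin

section \<open>Polynomial-time computation\<close>

text \<open>
  The machine model is the random access machine with input tape, output tape and
  logarithmic cost (Cook and Reckhow; Aho, Hopcroft and Ullman), which is polynomially
  equivalent to the multitape Turing machine.  Control flow is structured instead of
  given by jumps.  Registers hold arbitrary integers, and every access is charged the
  length of all integers involved, register addresses included.  A negative indirect
  address denotes register \<open>0\<close>.
\<close>

definition int_len :: "int \<Rightarrow> nat" where
  \<comment> \<open>binary digits plus a sign\<close>
  "int_len x = 1 + floorlog 2 (nat \<bar>x\<bar>)"

definition input_len :: "int list \<Rightarrow> nat" where
  "input_len xs = sum_list (map int_len xs)"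

type_synonym mem = "nat \<Rightarrow> int"

datatype operand = Const int | Reg nat | Ind nat

fun operand_val :: "mem \<Rightarrow> operand \<Rightarrow> int" where
  "operand_val s (Const x) = x"
| "operand_val s (Reg r) = s r"
| "operand_val s (Ind r) = s (nat (s r))"

fun operand_cost :: "mem \<Rightarrow> operand \<Rightarrow> nat" where
  "operand_cost s (Const x) = int_len x"
| "operand_cost s (Reg r) = int_len (int r) + int_len (s r)"
| "operand_cost s (Ind r) = int_len (int r) + int_len (s r) + int_len (s (nat (s r)))"

datatype dest = To_Reg nat | To_Ind nat

fun dest_addr :: "mem \<Rightarrow> dest \<Rightarrow> nat" where
  "dest_addr s (To_Reg r) = r"
| "dest_addr s (To_Ind r) = nat (s r)"

fun dest_cost :: "mem \<Rightarrow> dest \<Rightarrow> nat" where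
  "dest_cost s (To_Reg r) = int_len (int r)"
| "dest_cost s (To_Ind r) = int_len (int r) + int_len (s r)"

datatype arith_op = Plus | Minus | Times

fun arith :: "arith_op \<Rightarrow> int \<Rightarrow> int \<Rightarrow> int" where
  "arith Plus x y = x + y"
| "arith Minus x y = x - y"
| "arith Times x y = x * y"

datatype com =
    Arith dest arith_op operand operand
  | Read dest
  | Write operand
  | Seq com com
  | If_Pos operand com com
  | While_Pos operand com

text \<open>A configuration consists of the memory, the unread input and the output so far.\<close>

type_synonym config = "mem \<times> int list \<times> int list"

text \<open>\<open>exec c \<sigma> t \<tau>\<close>: started in \<open>\<sigma>\<close>, the program \<open>c\<close> halts in \<open>\<tau>\<close> at total cost \<open>t\<close>.
  A program that reads beyond the end of its input has no execution.\<close>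

inductive exec :: "com \<Rightarrow> config \<Rightarrow> nat \<Rightarrow> config \<Rightarrow> bool" where
  Arith: "exec (Arith d f a b) (s, inp, out)
            (1 + operand_cost s a + operand_cost s b + dest_cost s d)
            (s(dest_addr s d := arith f (operand_val s a) (operand_val s b)), inp, out)"
| Read: "exec (Read d) (s, x # inp, out)
            (1 + int_len x + dest_cost s d)
            (s(dest_addr s d := x), inp, out)"
| Write: "exec (Write a) (s, inp, out)
            (1 + operand_cost s a)
            (s, inp, out @ [operand_val s a])"
| Seq: "exec c\<^sub>1 \<sigma> t\<^sub>1 \<sigma>' \<Longrightarrow> exec c\<^sub>2 \<sigma>' t\<^sub>2 \<sigma>'' \<Longrightarrow> exec (Seq c\<^sub>1 c\<^sub>2) \<sigma> (t\<^sub>1 + t\<^sub>2) \<sigma>''"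
| If_True: "operand_val s a > 0 \<Longrightarrow> exec c\<^sub>1 (s, inp, out) t \<tau> \<Longrightarrow>
            exec (If_Pos a c\<^sub>1 c\<^sub>2) (s, inp, out) (1 + operand_cost s a + t) \<tau>"
| If_False: "\<not> operand_val s a > 0 \<Longrightarrow> exec c\<^sub>2 (s, inp, out) t \<tau> \<Longrightarrow>
            exec (If_Pos a c\<^sub>1 c\<^sub>2) (s, inp, out) (1 + operand_cost s a + t) \<tau>"
| While_False: "\<not> operand_val s a > 0 \<Longrightarrow>
            exec (While_Pos a c) (s, inp, out) (1 + operand_cost s a) (s, inp, out)"
| While_True: "operand_val s a > 0 \<Longrightarrow> exec c (s, inp, out) t\<^sub>1 \<sigma>' \<Longrightarrow>
            exec (While_Pos a c) \<sigma>' t\<^sub>2 \<tau> \<Longrightarrow>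
            exec (While_Pos a c) (s, inp, out) (1 + operand_cost s a + t\<^sub>1 + t\<^sub>2) \<tau>"

inductive_cases exec_ArithE: "exec (Arith d f a b) \<sigma> t \<tau>"
inductive_cases exec_ReadE: "exec (Read d) \<sigma> t \<tau>"
inductive_cases exec_WriteE: "exec (Write a) \<sigma> t \<tau>"
inductive_cases exec_SeqE: "exec (Seq c\<^sub>1 c\<^sub>2) \<sigma> t \<tau>"
inductive_cases exec_IfE: "exec (If_Pos a c\<^sub>1 c\<^sub>2) \<sigma> t \<tau>"
inductive_cases exec_WhileE: "exec (While_Pos a c) \<sigma> t \<tau>"

lemma exec_deterministic:
  "exec c \<sigma> t \<tau> \<Longrightarrow> exec c \<sigma> t' \<tau>' \<Longrightarrow> t' = t \<and> \<tau>' = \<tau>"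
proof (induction arbitrary: t' \<tau>' rule: exec.induct)
  case Arith
  from Arith.prems show ?case by (rule exec_ArithE) simp
next
  case Read
  from Read.prems show ?case by (rule exec_ReadE) simp
next
  case Write
  from Write.prems show ?case by (rule exec_WriteE) simp
next
  case (Seq c\<^sub>1 \<sigma> t\<^sub>1 \<sigma>' c\<^sub>2 t\<^sub>2 \<sigma>'')
  from Seq.prems show ?case
  proof (rule exec_SeqE)
    fix u\<^sub>1 \<rho> u\<^sub>2
    assume t': "t' = u\<^sub>1 + u\<^sub>2" and "exec c\<^sub>1 \<sigma> u\<^sub>1 \<rho>" "exec c\<^sub>2 \<rho> u\<^sub>2 \<tau>'"
    from Seq.IH(1)[OF this(2)] have 1: "u\<^sub>1 = t\<^sub>1" "\<rho> = \<sigma>'" by blast+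
    from Seq.IH(2)[OF \<open>exec c\<^sub>2 \<rho> u\<^sub>2 \<tau>'\<close>[unfolded 1]] 1 t' show ?thesis by simp
  qed
next
  case (If_True s a c\<^sub>1 inp out t \<tau> c\<^sub>2)
  from If_True.prems show ?case
  proof (rule exec_IfE)
    fix s' inp' out' u
    assume eqs: "(s, inp, out) = (s', inp', out')" "t' = Suc (operand_cost s' a + u)"
      and "exec c\<^sub>1 (s', inp', out') u \<tau>'"
    from If_True.IH[OF this(3)[folded eqs(1)]] eqs show ?thesis by simp
  qed (use If_True.hyps in simp)
next
  case (If_False s a c\<^sub>2 inp out t \<tau> c\<^sub>1)
  from If_False.prems show ?case
  proof (rule exec_IfE)
    fix s' inp' out' u
    assume eqs: "(s, inp, out) = (s', inp', out')" "t' = Suc (operand_cost s' a + u)"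
      and "exec c\<^sub>2 (s', inp', out') u \<tau>'"
    from If_False.IH[OF this(3)[folded eqs(1)]] eqs show ?thesis by simp
  qed (use If_False.hyps in simp)
next
  case While_False
  from While_False.prems show ?case
    by (rule exec_WhileE) (use While_False.hyps in simp_all)
next
  case (While_True s a c inp out t\<^sub>1 \<sigma>' t\<^sub>2 \<tau>)
  from While_True.prems show ?case
  proof (rule exec_WhileE)
    fix s' inp' out' u\<^sub>1 \<rho> u\<^sub>2
    assume eqs: "(s, inp, out) = (s', inp', out')" "t' = Suc (operand_cost s' a + u\<^sub>1 + u\<^sub>2)"
      and body: "exec c (s', inp', out') u\<^sub>1 \<rho>" and loop: "exec (While_Pos a c) \<rho> u\<^sub>2 \<tau>'"
    from While_True.IH(1)[OF body[folded eqs(1)]] have 1: "u\<^sub>1 = t\<^sub>1" "\<rho> = \<sigma>'" by blast+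
    from While_True.IH(2)[OF loop[unfolded 1]] 1 eqs show ?thesis by simp
  qed (use While_True.hyps in simp_all)
qed

text \<open>\<open>f\<close> is computed on the arguments in \<open>A\<close>, given and returned in the encodings \<open>enc\<close>
  and \<open>enc'\<close>, in time polynomial in the length of the encoded argument.  The memory is
  initially zero.\<close>

definition polytime_computable_on ::
    "'a set \<Rightarrow> ('a \<Rightarrow> int list) \<Rightarrow> ('b \<Rightarrow> int list) \<Rightarrow> ('a \<Rightarrow> 'b) \<Rightarrow> bool" where
  "polytime_computable_on A enc enc' f \<longleftrightarrow>
     (\<exists>(c :: com) (q :: nat poly). \<forall>x\<in>A. \<exists>t s inp.
        exec c (\<lambda>_. 0, enc x, []) t (s, inp, enc' (f x)) \<and> t \<le> poly q (input_len (enc x)))"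


section \<open>Promise problems and Karp reductions\<close>

record 'a promise_problem =
  yes_instances :: "'a set"
  no_instances :: "'a set"
  encode :: "'a \<Rightarrow> int list"

definition instances :: "'a promise_problem \<Rightarrow> 'a set" where
  "instances P = yes_instances P \<union> no_instances P"

definition karp_reduction ::
    "'a promise_problem \<Rightarrow> 'b promise_problem \<Rightarrow> ('a \<Rightarrow> 'b) \<Rightarrow> bool" where
  "karp_reduction P Q f \<longleftrightarrow>
     polytime_computable_on (instances P) (encode P) (encode Q) f \<and>
     (\<forall>x\<in>yes_instances P. f x \<in> yes_instances Q) \<and>
     (\<forall>x\<in>no_instances P. f x \<in> no_instances Q)"


section \<open>The \<open>(0,1)\<close>-closest vector problem\<close>

definition lp_norm :: "real \<Rightarrow> real vec \<Rightarrow> real" where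
  "lp_norm p v = (\<Sum>i<dim_vec v. \<bar>v $ i\<bar> powr p) powr (1 / p)"

definition lin_indpt_cols :: "real mat \<Rightarrow> bool" where
  "lin_indpt_cols A \<longleftrightarrow> distinct (cols A) \<and>
     LinearCombinations.module.lin_indpt class_ring (module_vec TYPE(real) (dim_row A))
       (set (cols A))"

text \<open>The distance bound is rational so that an instance is a finite object.\<close>

record cvp_instance =
  basis :: "int mat"
  target :: "int vec"
  dist_bound :: rat

definition lattice_rank :: "cvp_instance \<Rightarrow> nat" where
  "lattice_rank I = dim_col (basis I)"

definition valid_cvp :: "cvp_instance \<Rightarrow> bool" where
  "valid_cvp I \<longleftrightarrow>
     lin_indpt_cols (map_mat real_of_int (basis I)) \<and>
     target I \<in> carrier_vec (dim_row (basis I)) \<and>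
     dist_bound I > 0"

definition binary_vecs :: "nat \<Rightarrow> int vec set" where
  "binary_vecs n = {z \<in> carrier_vec n. \<forall>i<n. z $ i \<in> {0, 1}}"

definition cvp_dist :: "real \<Rightarrow> cvp_instance \<Rightarrow> int vec \<Rightarrow> real" where
  "cvp_dist p I z = lp_norm p (map_vec real_of_int (basis I *\<^sub>v z - target I))"

text \<open>The dimensions, the entries of the basis row by row, the target, and the distance
  bound as a reduced fraction.\<close>

definition encode_cvp :: "cvp_instance \<Rightarrow> int list" where
  "encode_cvp I =
     [int (dim_row (basis I)), int (dim_col (basis I))] @ concat (mat_to_list (basis I)) @
     list_of_vec (target I) @
     [fst (quotient_of (dist_bound I)), snd (quotient_of (dist_bound I))]"

definition zero_one_CVP :: "real \<Rightarrow> cvp_instance promise_problem" where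
  "zero_one_CVP p = \<lparr>
     yes_instances = {I. valid_cvp I \<and>
       (\<exists>z\<in>binary_vecs (lattice_rank I). cvp_dist p I z \<le> real_of_rat (dist_bound I))},
     no_instances = {I. valid_cvp I \<and>
       (\<forall>z\<in>binary_vecs (lattice_rank I). cvp_dist p I z > real_of_rat (dist_bound I))},
     encode = encode_cvp \<rparr>"


section \<open>Weighted Max-\<open>k\<close>-SAT\<close>

text \<open>The variables of a formula on \<open>n\<close> variables are \<open>0, \<dots>, n - 1\<close>.\<close>

datatype literal = Pos nat | Neg nat

fun lit_var :: "literal \<Rightarrow> nat" where
  "lit_var (Pos i) = i"
| "lit_var (Neg i) = i"

fun lit_true :: "(nat \<Rightarrow> bool) \<Rightarrow> literal \<Rightarrow> bool" where
  "lit_true \<alpha> (Pos i) \<longleftrightarrow> \<alpha> i"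
| "lit_true \<alpha> (Neg i) \<longleftrightarrow> \<not> \<alpha> i"

type_synonym clause = "literal list"

definition clause_true :: "(nat \<Rightarrow> bool) \<Rightarrow> clause \<Rightarrow> bool" where
  "clause_true \<alpha> C \<longleftrightarrow> (\<exists>l\<in>set C. lit_true \<alpha> l)"

text \<open>The \<open>i\<close>-th list element is the clause \<open>C\<^sub>i\<close> together with its weight.\<close>

record maxsat_instance =
  num_vars :: nat
  wclauses :: "(clause \<times> nat) list"
  threshold :: int

definition valid_maxsat :: "nat \<Rightarrow> maxsat_instance \<Rightarrow> bool" where
  "valid_maxsat k J \<longleftrightarrow>
     (\<forall>(C, w)\<in>set (wclauses J). length C \<le> k \<and> (\<forall>l\<in>set C. lit_var l < num_vars J))"

definition satisfied_weight :: "maxsat_instance \<Rightarrow> (nat \<Rightarrow> bool) \<Rightarrow> int" where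
  "satisfied_weight J \<alpha> =
     (\<Sum>(C, w)\<leftarrow>wclauses J. if clause_true \<alpha> C then int w else 0)"

text \<open>As in the DIMACS format, literals are nonzero integers and a clause, preceded by
  its weight, is terminated by \<open>0\<close>.\<close>

fun encode_lit :: "literal \<Rightarrow> int" where
  "encode_lit (Pos i) = int i + 1"
| "encode_lit (Neg i) = - (int i + 1)"

definition encode_wclause :: "clause \<times> nat \<Rightarrow> int list" where
  "encode_wclause = (\<lambda>(C, w). [int w] @ map encode_lit C @ [0])"

definition encode_maxsat :: "maxsat_instance \<Rightarrow> int list" where
  "encode_maxsat J =
     [int (num_vars J)] @ concat (map encode_wclause (wclauses J)) @ [threshold J]"

definition weighted_Max_SAT :: "nat \<Rightarrow> maxsat_instance promise_problem" where
  "weighted_Max_SAT k = \<lparr>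
     yes_instances = {J. valid_maxsat k J \<and> (\<exists>\<alpha>. satisfied_weight J \<alpha> \<ge> threshold J)},
     no_instances = {J. valid_maxsat k J \<and> (\<forall>\<alpha>. satisfied_weight J \<alpha> < threshold J)},
     encode = encode_maxsat \<rparr>"


section \<open>The encodings are unambiguous\<close>

lemma encode_lit_neq_0: "encode_lit l \<noteq> 0"
  by (cases l) auto

lemma encode_lit_inject: "encode_lit l = encode_lit l' \<Longrightarrow> l = l'"
  by (cases l; cases l') auto

lemma encode_lits_prefix:
  "map encode_lit C @ 0 # xs = map encode_lit C' @ 0 # ys \<Longrightarrow> C = C' \<and> xs = ys"
proof (induction C arbitrary: C')
  case Nil
  then show ?case by (cases C') (auto simp: encode_lit_neq_0 dest: sym)
next
  case (Cons l C)
  then show ?case by (cases C') (auto simp: encode_lit_neq_0 encode_lit_inject)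
qed

lemma encode_wclauses_inject:
  "concat (map encode_wclause cs) = concat (map encode_wclause cs') \<Longrightarrow> cs = cs'"
proof (induction cs arbitrary: cs')
  case Nil
  then show ?case by (cases cs') (auto simp: encode_wclause_def)
next
  case (Cons c cs)
  obtain C w where c: "c = (C, w)" by fastforce
  from Cons.prems obtain c' cs'' where cs': "cs' = c' # cs''"
    by (cases cs') (auto simp: encode_wclause_def c)
  obtain C' w' where c': "c' = (C', w')" by fastforce
  from Cons.prems have "w' = w" "C = C'"
    and "concat (map encode_wclause cs) = concat (map encode_wclause cs'')"
    by (auto simp: cs' c c' encode_wclause_def dest!: encode_lits_prefix)
  then show ?case using Cons.IH by (simp add: cs' c c')
qed

lemma inj_encode_maxsat: "inj encode_maxsat"
proof (rule injI)
  fix J J' :: maxsat_instance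
  assume "encode_maxsat J = encode_maxsat J'"
  then show "J = J'"
    by (cases J; cases J') (auto simp: encode_maxsat_def dest: encode_wclauses_inject)
qed

lemma length_concat_mat_to_list: "length (concat (mat_to_list A)) = dim_row A * dim_col A"
  by (simp add: mat_to_list_def length_concat o_def sum_list_triv)

lemma concat_mat_to_list_inject:
  assumes "dim_row A = dim_row B" "dim_col A = dim_col B"
    and eq: "concat (mat_to_list A) = concat (mat_to_list B)"
  shows "A = B"
proof -
  have len: "length (mat_to_list A) = length (mat_to_list B)"
    using assms by (simp add: mat_to_list_def)
  have "mat_to_list A = mat_to_list B"
    by (rule concat_injective[OF eq len])
       (use assms in \<open>auto simp: mat_to_list_def in_set_zip\<close>)
  then show ?thesis
    using assms by (intro eq_matI) (auto simp: mat_to_list_def)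
qed

lemma inj_on_encode_cvp: "inj_on encode_cvp {I. valid_cvp I}"
proof (rule inj_onI)
  fix I J assume *: "I \<in> {I. valid_cvp I}" "J \<in> {I. valid_cvp I}"
    and eq: "encode_cvp I = encode_cvp J"
  have dims: "dim_row (basis I) = dim_row (basis J)" "dim_col (basis I) = dim_col (basis J)"
    using eq by (auto simp: encode_cvp_def)
  have mats: "concat (mat_to_list (basis I)) = concat (mat_to_list (basis J))"
    and rest: "list_of_vec (target I) = list_of_vec (target J)"
      "quotient_of (dist_bound I) = quotient_of (dist_bound J)"
    using eq dims * by (auto simp: encode_cvp_def length_concat_mat_to_list prod_eq_iff)
  have "basis I = basis J" by (rule concat_mat_to_list_inject[OF dims mats])
  moreover have "target I = target J" using rest(1) by (metis vec_list)
  moreover have "dist_bound I = dist_bound J"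
    using rest(2) by (simp add: quotient_of_inject_eq)
  ultimately show "I = J" by simp
qed

end

theory Submission
  imports Defs
begin

text \<open>
  For a distance bound \<open>a / b\<close> and even \<open>p\<close>, closeness means \<open>b\<^sup>p \<Sum>\<^sub>i ((Bz)\<^sub>i - t\<^sub>i)\<^sup>p \<le> a\<^sup>p\<close>.  Multiplying out the
  \<open>p\<close> factors of each summand, without collecting equal monomials, gives at most \<open>m (n + 1)\<^sup>p\<close> terms
  \<open>P z\<^sub>v\<^sub>1 \<dots> z\<^sub>v\<^sub>r\<close> with \<open>r \<le> p\<close>.  For 0-1 variables \<open>1 - z\<^sub>v\<^sub>1 \<dots> z\<^sub>v\<^sub>r\<close> is the truth value of the clause
  \<open>\<not> v\<^sub>1 \<or> \<dots> \<or> \<not> v\<^sub>r\<close>, which handles \<open>P > 0\<close>.  For \<open>P \<le> 0\<close> one uses that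
  \<open>z\<^sub>v\<^sub>1 \<dots> z\<^sub>v\<^sub>r + r - 1\<close> is the number of true clauses among
  \<open>\<not> v\<^sub>1 \<or> \<dots> \<or> \<not> v\<^sub>k\<^sub>-\<^sub>1 \<or> v\<^sub>k\<close>, \<open>k = 1, \<dots>, r\<close>.  So a constant minus the polynomial is a
  nonnegative combination of clauses with at most \<open>p\<close> literals.  Since \<open>p\<close> is fixed, \<open>p\<close> nested loops of
  a random access machine enumerate the terms in polynomial time.
\<close>

section \<open>The expansion into clauses\<close>

text \<open>The accumulators \<open>P\<close> and \<open>vs\<close> hold the coefficient and the
  variables picked so far. The order is that of the program's output: loops count down, hence
  \<open>rev\<close>, and the choice of the constant \<open>- t\<close> comes after the
  loop.\<close>

fun terms :: "nat \<Rightarrow> (nat \<Rightarrow> int) \<Rightarrow> int \<Rightarrow> nat \<Rightarrow> int \<Rightarrow> nat list \<Rightarrow> (int \<times> nat list) list" where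
  "terms n coef t 0 P vs = [(P, vs)]"
| "terms n coef t (Suc k) P vs =
     concat (map (\<lambda>j. terms n coef t k (P * coef j) (vs @ [j])) (rev [0..<n])) @
     terms n coef t k (P * - t) vs"

text \<open>Weights are naturals, which forces the split on the sign of \<open>P\<close>. For
  \<open>vs = []\<close> the result is the empty clause, which is never true, or no clause at all;
  \<open>term_const\<close> is \<open>P\<close> in both cases.\<close>

fun term_clauses :: "int \<times> nat list \<Rightarrow> (clause \<times> nat) list" where
  "term_clauses (P, vs) =
     (if P > 0 then [(map Neg vs, nat P)]
      else map (\<lambda>k. (map Neg (take k vs) @ [Pos (vs ! k)], nat (- P))) [0..<length vs])"

fun term_const :: "int \<times> nat list \<Rightarrow> int" where
  "term_const (P, vs) = (if P > 0 then P else - P * (int (length vs) - 1))"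

definition encode_terms :: "(int \<times> nat list) list \<Rightarrow> int list" where
  "encode_terms ts = concat (map encode_wclause (concat (map term_clauses ts)))"

definition const_sum :: "(int \<times> nat list) list \<Rightarrow> int" where
  "const_sum ts = (\<Sum>x\<leftarrow>ts. term_const x)"

text \<open>The program adds up \<open>const_sum\<close> term by term, and because of cancellation a
  partial sum can exceed the total in size. The sum of absolute values bounds them all.\<close>

definition const_abs_sum :: "(int \<times> nat list) list \<Rightarrow> int" where
  "const_abs_sum ts = (\<Sum>x\<leftarrow>ts. \<bar>term_const x\<bar>)"

lemma encode_terms_simps [simp]:
  "encode_terms [] = []"
  "encode_terms (ts @ us) = encode_terms ts @ encode_terms us"
  by (simp_all add: encode_terms_def)

lemma const_sum_simps [simp]:
  "const_sum [] = 0"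
  "const_sum (ts @ us) = const_sum ts + const_sum us"
  by (simp_all add: const_sum_def)

lemma const_abs_sum_simps [simp]:
  "const_abs_sum [] = 0"
  "const_abs_sum (ts @ us) = const_abs_sum ts + const_abs_sum us"
  by (simp_all add: const_abs_sum_def)

lemma abs_const_sum_le: "\<bar>const_sum ts\<bar> \<le> const_abs_sum ts"
  unfolding const_sum_def const_abs_sum_def by (induction ts) auto

lemma const_abs_sum_nonneg: "0 \<le> const_abs_sum ts"
  using abs_const_sum_le[of ts] by linarith

definition all_terms :: "nat \<Rightarrow> nat \<Rightarrow> nat \<Rightarrow> (nat \<Rightarrow> nat \<Rightarrow> int) \<Rightarrow> (nat \<Rightarrow> int) \<Rightarrow> int \<Rightarrow> (int \<times> nat list) list" where
  "all_terms p m n B t P = concat (map (\<lambda>i. terms n (B i) (t i) p P []) (rev [0..<m]))"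

lemma terms_cong:
  "(\<And>j. j < n \<Longrightarrow> c j = c' j) \<Longrightarrow> terms n c t k P vs = terms n c' t k P vs"
  by (induction k arbitrary: P vs) (auto intro!: arg_cong[where f = concat] map_cong)

text \<open>Each factor contributes at most one variable; for a \<open>p\<close>-th power this
  limits the clause width to \<open>p\<close>.\<close>

lemma terms_vars:
  "(Q, us) \<in> set (terms n c t k P vs) \<Longrightarrow> length us \<le> k + length vs \<and> set us \<subseteq> set vs \<union> {..<n}"
  by (induction k arbitrary: P vs) fastforce+

lemma sum_list_rev_upt: "(\<Sum>j\<leftarrow>rev [0..<n]. f j) = (\<Sum>j<n. f j :: 'a :: comm_monoid_add)"
  by (simp add: sum_list_rev flip: rev_map) (simp add: interv_sum_list_conv_sum_set_nat atLeast0LessThan)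

section \<open>Evaluation of terms and clauses at an assignment\<close>

definition term_value :: "(nat \<Rightarrow> int) \<Rightarrow> int \<times> nat list \<Rightarrow> int" where
  "term_value f = (\<lambda>(P, vs). P * (\<Prod>v\<leftarrow>vs. f v))"

lemma sum_list_concat: "sum_list (concat xss) = (\<Sum>xs\<leftarrow>xss. sum_list xs :: 'a :: monoid_add)"
  by (induction xss) auto

text \<open>Distributivity, one factor at a time: picking summand \<open>j\<close> contributes
  \<open>c j * f j\<close>, picking the constant contributes \<open>- t\<close>.\<close>

lemma sum_terms_value:
  "(\<Sum>x\<leftarrow>terms n c t k P vs. term_value f x) =
     P * (\<Prod>v\<leftarrow>vs. f v) * ((\<Sum>j<n. c j * f j) - t) ^ k"
proof (induction k arbitrary: P vs)
  case 0
  then show ?case by (simp add: term_value_def)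
next
  case (Suc k)
  let ?L = "\<Sum>j<n. c j * f j" and ?V = "\<Prod>v\<leftarrow>vs. f v"
  have "(\<Sum>x\<leftarrow>terms n c t (Suc k) P vs. term_value f x) =
      (\<Sum>j<n. P * c j * (?V * f j) * (?L - t) ^ k) + P * - t * ?V * (?L - t) ^ k"
    by (simp add: sum_list_concat map_concat o_def Suc sum_list_rev_upt del: upt_Suc)
  also have "(\<Sum>j<n. P * c j * (?V * f j) * (?L - t) ^ k) = P * ?V * ?L * (?L - t) ^ k"
    by (simp add: sum_distrib_left sum_distrib_right ac_simps)
  finally show ?case by (simp add: algebra_simps)
qed

lemma clause_true_map_Neg: "clause_true \<alpha> (map Neg vs) \<longleftrightarrow> \<not> (\<forall>v\<in>set vs. \<alpha> v)"
  by (auto simp: clause_true_def)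

lemma prod_list_of_bool: "(\<Prod>v\<leftarrow>vs. of_bool (\<alpha> v)) = (of_bool (\<forall>v\<in>set vs. \<alpha> v) :: int)"
  by (induction vs) auto

text \<open>If not all of \<open>vs\<close> are true, then exactly one of these clauses fails, namely the one of the first
  false variable.\<close>

lemma sum_prefix_clauses:
  "(\<Sum>k<length vs. of_bool (clause_true \<alpha> (map Neg (take k vs) @ [Pos (vs ! k)]))) =
     int (length vs) - 1 + of_bool (\<forall>v\<in>set vs. \<alpha> v)"
proof (induction vs rule: rev_induct)
  case (snoc v vs)
  have "(\<Sum>k<length vs. of_bool (clause_true \<alpha> (map Neg (take k (vs @ [v])) @ [Pos ((vs @ [v]) ! k)]))) =
      (\<Sum>k<length vs. of_bool (clause_true \<alpha> (map Neg (take k vs) @ [Pos (vs ! k)])) :: int)"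
    by (intro sum.cong) (auto simp: nth_append)
  with snoc show ?case
    by (auto simp: clause_true_def)
qed simp

text \<open>For either sign of \<open>P\<close> the value of the term enters with a minus sign, so a
  small polynomial value turns into a large satisfied weight.\<close>

lemma term_clauses_weight:
  "(\<Sum>(C, w)\<leftarrow>term_clauses x. if clause_true \<alpha> C then int w else 0) =
     term_const x - term_value (\<lambda>v. of_bool (\<alpha> v)) x"
proof (cases x)
  case (Pair P vs)
  show ?thesis
  proof (cases "P > 0")
    case True
    then show ?thesis
      by (simp add: Pair term_value_def prod_list_of_bool clause_true_map_Neg)
  next
    case False
    let ?C = "\<lambda>k. map Neg (take k vs) @ [Pos (vs ! k)]"
    have "(\<Sum>(C, w)\<leftarrow>term_clauses x. if clause_true \<alpha> C then int w else 0) =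
        (\<Sum>k<length vs. - P * of_bool (clause_true \<alpha> (?C k)))"
      using False by (simp add: Pair o_def interv_sum_list_conv_sum_set_nat atLeast0LessThan if_distrib
          of_bool_def cong: if_cong)
    also have "\<dots> = - P * (int (length vs) - 1 + of_bool (\<forall>v\<in>set vs. \<alpha> v))"
      by (simp only: sum_prefix_clauses flip: sum_distrib_left)
    finally show ?thesis
      using False by (simp add: Pair term_value_def prod_list_of_bool algebra_simps)
  qed
qed

lemma terms_weight:
  "(\<Sum>(C, w)\<leftarrow>concat (map term_clauses ts). if clause_true \<alpha> C then int w else 0) =
     const_sum ts - (\<Sum>x\<leftarrow>ts. term_value (\<lambda>v. of_bool (\<alpha> v)) x)"
  by (induction ts) (auto simp: const_sum_def term_clauses_weight)

lemma sum_all_terms_value: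
  "(\<Sum>x\<leftarrow>all_terms p m n B t P. term_value f x) = P * (\<Sum>i<m. ((\<Sum>j<n. B i j * f j) - t i) ^ p)"
  by (simp add: all_terms_def sum_list_concat map_concat o_def sum_terms_value sum_list_rev_upt
      sum_distrib_left del: upt_Suc)

text \<open>The recursion has \<open>(n + 1) ^ k\<close> leaves with coefficients of size at most
  \<open>\<bar>P\<bar> * X ^ k\<close>, and \<open>term_const\<close> adds a factor linear in the
  number of variables. Along a branch \<open>length vs + k\<close> never grows, which gives the last
  factor.\<close>

lemma const_abs_sum_terms:
  assumes "\<And>j. j < n \<Longrightarrow> \<bar>c j\<bar> \<le> X" "\<bar>t\<bar> \<le> X" "1 \<le> X"
  shows "const_abs_sum (terms n c t k P vs) \<le> (int n + 1) ^ k * (\<bar>P\<bar> * X ^ k * int (length vs + k + 1))"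
proof (induction k arbitrary: P vs)
  case 0
  \<comment> \<open>The \<open>+ 1\<close> covers the empty list, where the second absolute value is
    1.\<close>
  have "\<bar>P\<bar> * \<bar>int (length vs) - 1\<bar> \<le> \<bar>P\<bar> * (int (length vs) + 1)"
    by (intro mult_left_mono) auto
  moreover have "\<bar>P\<bar> \<le> \<bar>P\<bar> * (int (length vs) + 1)"
    by (simp add: distrib_left)
  ultimately have "\<bar>term_const (P, vs)\<bar> \<le> \<bar>P\<bar> * (int (length vs) + 1)"
    by (auto simp only: term_const.simps abs_mult abs_minus split: if_split)
  then show ?case by (simp add: const_abs_sum_def ac_simps)
next
  case (Suc k)
  let ?b = "(int n + 1) ^ k * (\<bar>P\<bar> * X ^ Suc k * int (length vs + Suc k + 1))"
  have le: "const_abs_sum (terms n c t k (P * x) us) \<le> ?b" if "\<bar>x\<bar> \<le> X" "length us \<le> Suc (length vs)" for x us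
  proof -
    have "const_abs_sum (terms n c t k (P * x) us) \<le> (int n + 1) ^ k * (\<bar>P * x\<bar> * X ^ k * int (length us + k + 1))"
      by (rule Suc)
    also have "\<dots> \<le> (int n + 1) ^ k * ((\<bar>P\<bar> * X) * X ^ k * int (length vs + Suc k + 1))"
      unfolding abs_mult using that \<open>1 \<le> X\<close> by (intro mult_left_mono mult_mono) auto
    finally show ?thesis by (simp add: ac_simps)
  qed
  have "const_abs_sum (concat (map (\<lambda>j. terms n c t k (P * c j) (vs @ [j])) (rev [0..<n]))) =
      (\<Sum>j<n. const_abs_sum (terms n c t k (P * c j) (vs @ [j])))"
    by (simp add: const_abs_sum_def sum_list_concat map_concat o_def sum_list_rev_upt del: upt_Suc)
  also have "\<dots> \<le> (\<Sum>j<n. ?b)"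
    using assms by (intro sum_mono le) auto
  finally have "const_abs_sum (concat (map (\<lambda>j. terms n c t k (P * c j) (vs @ [j])) (rev [0..<n]))) \<le> int n * ?b"
    by simp
  moreover have "const_abs_sum (terms n c t k (P * - t) vs) \<le> ?b"
    using assms by (intro le) auto
  ultimately have "const_abs_sum (terms n c t (Suc k) P vs) \<le> int n * ?b + ?b"
    unfolding terms.simps const_abs_sum_simps by (rule add_mono)
  also have "\<dots> = (int n + 1) ^ Suc k * (\<bar>P\<bar> * X ^ Suc k * int (length vs + Suc k + 1))"
    by (simp add: algebra_simps)
  finally show ?case .
qed

lemma const_abs_sum_all_terms:
  assumes "\<And>i j. i < m \<Longrightarrow> j < n \<Longrightarrow> \<bar>B i j\<bar> \<le> X" "\<And>i. i < m \<Longrightarrow> \<bar>t i\<bar> \<le> X" "1 \<le> X"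
  shows "const_abs_sum (all_terms p m n B t P) \<le> int m * ((int n + 1) ^ p * (\<bar>P\<bar> * X ^ p * int (p + 1)))"
proof -
  have "const_abs_sum (all_terms p m n B t P) = (\<Sum>i<m. const_abs_sum (terms n (B i) (t i) p P []))"
    by (simp add: all_terms_def const_abs_sum_def sum_list_concat map_concat o_def sum_list_rev_upt del: upt_Suc)
  also have "\<dots> \<le> (\<Sum>i<m. (int n + 1) ^ p * (\<bar>P\<bar> * X ^ p * int (p + 1)))"
    using const_abs_sum_terms[of n "B i" X "t i" p P "[]" for i] assms by (intro sum_mono) simp
  finally show ?thesis by simp
qed

section \<open>From the norm to an integer inequality\<close>

lemma powr_inverse_le_iff:
  fixes x d :: real
  assumes "0 \<le> x" "0 < d" "0 < p"
  shows "x powr (1 / p) \<le> d \<longleftrightarrow> x \<le> d powr p"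
proof
  assume "x powr (1 / p) \<le> d"
  then have "(x powr (1 / p)) powr p \<le> d powr p"
    using assms by (intro powr_mono2) auto
  then show "x \<le> d powr p" using assms by (simp add: powr_powr)
next
  assume "x \<le> d powr p"
  then have "x powr (1 / p) \<le> (d powr p) powr (1 / p)"
    using assms by (intro powr_mono2) auto
  then show "x powr (1 / p) \<le> d" using assms by (simp add: powr_powr)
qed

text \<open>Evenness of \<open>p\<close> removes the absolute values, so the \<open>p\<close>-th
  power of the norm is an integer; positivity of \<open>d\<close> allows comparing
  \<open>p\<close>-th powers instead.\<close>

lemma lp_norm_le_iff:
  assumes "even p" "p > 0" "d > 0"
  shows "lp_norm (real p) (map_vec real_of_int v) \<le> d \<longleftrightarrow> real_of_int (\<Sum>i<dim_vec v. (v $ i) ^ p) \<le> d ^ p"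
proof -
  have "\<bar>real_of_int x\<bar> powr real p = real_of_int (x ^ p)" for x
  \<comment> \<open>\<open>powr_realpow\<close> needs a positive base; at zero both sides vanish
    because \<open>p > 0\<close>.\<close>
  proof (cases "x = 0")
    case False
    then show ?thesis using \<open>even p\<close> by (simp add: powr_realpow power_even_abs)
  qed (use \<open>p > 0\<close> in simp)
  then have "(\<Sum>i<dim_vec v. \<bar>map_vec real_of_int v $ i\<bar> powr real p) = real_of_int (\<Sum>i<dim_vec v. (v $ i) ^ p)"
    by (simp add: of_int_sum)
  moreover
  have "0 \<le> (\<Sum>i<dim_vec v. (v $ i) ^ p)"
    using \<open>even p\<close> by (intro sum_nonneg) (simp add: zero_le_even_power)
  then have "0 \<le> real_of_int (\<Sum>i<dim_vec v. (v $ i) ^ p)"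
    by (simp only: of_int_0_le_iff)
  ultimately show ?thesis
    unfolding lp_norm_def using powr_inverse_le_iff[OF _ assms(3), of _ "real p"] assms(2,3)
    by (simp only: powr_realpow index_map_vec of_nat_0_less_iff)
qed

text \<open>Starting the expansion with the coefficient \<open>b ^ p\<close> clears the denominator
  of the distance bound.\<close>

definition reduction :: "nat \<Rightarrow> cvp_instance \<Rightarrow> maxsat_instance" where
  "reduction p I = (let (a, b) = quotient_of (dist_bound I);
       ts = all_terms p (dim_row (basis I)) (dim_col (basis I)) (\<lambda>i j. basis I $$ (i, j)) (\<lambda>i. target I $ i) (b ^ p)
     in \<lparr>num_vars = dim_col (basis I), wclauses = concat (map term_clauses ts), threshold = const_sum ts - a ^ p\<rparr>)"

text \<open>The prefix clause of index \<open>k < length us\<close> has \<open>k + 1\<close>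
  literals, so no clause is wider than its term has variables.\<close>

lemma valid_reduction: "valid_maxsat p (reduction p I)"
proof -
  obtain a b where q: "quotient_of (dist_bound I) = (a, b)" by fastforce
  have "length C \<le> p \<and> (\<forall>l\<in>set C. lit_var l < n)"
    if "(C, w) \<in> set (term_clauses x)" "x \<in> set (all_terms p m n B t P)" for C w x m n B t P
  proof -
    obtain Q us where x: "x = (Q, us)" by fastforce
    have us: "length us \<le> p" "set us \<subseteq> {..<n}"
      using that(2) terms_vars[of Q us n] unfolding x all_terms_def by fastforce+
    show ?thesis
      using that(1) us unfolding x by (auto simp: subset_iff split: if_splits dest!: in_set_takeD)
  qed
  then show ?thesis
    unfolding valid_maxsat_def reduction_def by (fastforce simp: q Let_def)
qed

lemma satisfied_weight_reduction:
  assumes "valid_cvp I" "even p" "p > 0"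
  shows "satisfied_weight (reduction p I) \<alpha> \<ge> threshold (reduction p I) \<longleftrightarrow>
     cvp_dist (real p) I (vec (lattice_rank I) (\<lambda>j. of_bool (\<alpha> j))) \<le> real_of_rat (dist_bound I)"
proof -
  obtain a b where q: "quotient_of (dist_bound I) = (a, b)" by fastforce
  have b: "b > 0" and d: "dist_bound I = of_int a / of_int b"
    using quotient_of_denom_pos[OF q] quotient_of_div[OF q] by auto
  have "dist_bound I > 0" using assms(1) by (simp add: valid_cvp_def)
  then have d_pos: "real_of_rat (dist_bound I) > 0" by simp
  have d': "real_of_rat (dist_bound I) = of_int a / of_int b"
    by (simp add: d of_rat_divide)
  let ?m = "dim_row (basis I)" and ?n = "dim_col (basis I)"
  let ?z = "vec ?n (\<lambda>j. of_bool (\<alpha> j)) :: int vec"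
  let ?v = "basis I *\<^sub>v ?z - target I"
  have dim: "dim_vec (target I) = ?m" using assms(1) by (simp add: valid_cvp_def)
  let ?S = "\<Sum>i<?m. ((\<Sum>j<?n. basis I $$ (i, j) * of_bool (\<alpha> j)) - target I $ i) ^ p"
  have "?v $ i = (\<Sum>j<?n. basis I $$ (i, j) * of_bool (\<alpha> j)) - target I $ i" if "i < ?m" for i
    using that dim by (simp add: scalar_prod_def atLeast0LessThan)
  then have S: "(\<Sum>i<dim_vec ?v. (?v $ i) ^ p) = ?S"
    using dim by simp
  \<comment> \<open>By \<open>terms_weight\<close> the satisfied weight is \<open>const_sum\<close>
    of the terms minus \<open>b ^ p * ?S\<close>; the constant cancels against the
    threshold.\<close>
  have "satisfied_weight (reduction p I) \<alpha> \<ge> threshold (reduction p I) \<longleftrightarrow> b ^ p * ?S \<le> a ^ p"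
    by (simp add: satisfied_weight_def reduction_def q Let_def terms_weight sum_all_terms_value)
  also have "\<dots> \<longleftrightarrow> real_of_int (b ^ p * ?S) \<le> real_of_int (a ^ p)"
    by (simp only: of_int_le_iff)
  also have "\<dots> \<longleftrightarrow> real_of_int ?S \<le> (of_int a / of_int b) ^ p"
    using b by (simp add: power_divide field_simps)
  also have "\<dots> \<longleftrightarrow> cvp_dist (real p) I ?z \<le> real_of_rat (dist_bound I)"
    unfolding cvp_dist_def lp_norm_le_iff[OF assms(2,3) d_pos] S unfolding d' ..
  finally show ?thesis by (simp add: lattice_rank_def)
qed

text \<open>Turns quantification over binary vectors into quantification over assignments.\<close>

lemma binary_vecs_eq: "binary_vecs n = range (\<lambda>\<alpha>. vec n (\<lambda>j. of_bool (\<alpha> j)))"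
proof (intro equalityI subsetI)
  fix z :: "int vec" assume "z \<in> binary_vecs n"
  then have "z = vec n (\<lambda>j. of_bool (z $ j = 1))"
    by (intro eq_vecI) (auto simp: binary_vecs_def)
  then show "z \<in> range (\<lambda>\<alpha>. vec n (\<lambda>j. of_bool (\<alpha> j)))" by (rule range_eqI[of _ _ "\<lambda>j. z $ j = 1"])
qed (auto simp: binary_vecs_def)

section \<open>Bounded execution\<close>

lemma int_len_mono: "\<bar>x\<bar> \<le> \<bar>y\<bar> \<Longrightarrow> int_len x \<le> int_len y"
  unfolding int_len_def by (intro add_left_mono floorlog_mono nat_mono)

lemma int_len_bound: "\<bar>x\<bar> < 2 ^ int_len x"
proof (cases "x = 0")
  case False
  let ?f = "floorlog 2 (nat \<bar>x\<bar>)"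
  have "nat \<bar>x\<bar> < 2 ^ ?f"
    using floorlog_bounds[of "nat \<bar>x\<bar>" 2] False by auto
  then have "\<bar>x\<bar> < 2 ^ ?f"
    by (metis abs_ge_zero nat_less_iff of_nat_numeral of_nat_power)
  also have "\<dots> \<le> 2 ^ int_len x"
    by (simp add: int_len_def)
  finally show ?thesis .
qed (simp add: int_len_def)

text \<open>There are \<open>e + 1\<close> digits and a sign. The register bound will be a power of
  two, so that the unit cost is linear in its exponent.\<close>

lemma int_len_power: "int_len (2 ^ e) = e + 2"
proof -
  have "nat \<bar>2 ^ e\<bar> = (2 ^ e :: nat)"
    by (metis abs_numeral nat_int of_nat_numeral of_nat_power power_abs)
  then show ?thesis
    by (simp add: int_len_def floorlog_def)
qed

definition skip :: com where
  "skip = Arith (To_Reg 0) Plus (Reg 0) (Const 0)"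

fun seqs :: "com list \<Rightarrow> com" where
  "seqs [] = skip"
| "seqs (c # cs) = Seq c (seqs cs)"

text \<open>As long as all registers are bounded by \<open>M\<close>, one instruction costs at most \<open>unit_cost\<close>, so that
  the running time can be counted in instructions.\<close>

locale machine =
  fixes M :: int
  assumes M_pos: "1 \<le> M"
begin

definition bdd :: "mem \<Rightarrow> bool" where
  "bdd s \<longleftrightarrow> (\<forall>r. \<bar>s r\<bar> \<le> M)"

text \<open>Addresses are charged as well and need a bound. The address used by \<open>Ind\<close>
  is itself a register content, hence covered by \<open>bdd\<close>.\<close>

fun op_ok :: "operand \<Rightarrow> bool" where
  "op_ok (Const x) \<longleftrightarrow> \<bar>x\<bar> \<le> M"
| "op_ok (Reg r) \<longleftrightarrow> int r \<le> M"
| "op_ok (Ind r) \<longleftrightarrow> int r \<le> M"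

fun dest_ok :: "dest \<Rightarrow> bool" where
  "dest_ok (To_Reg r) \<longleftrightarrow> int r \<le> M"
| "dest_ok (To_Ind r) \<longleftrightarrow> int r \<le> M"

text \<open>Two operands and a destination, each charged at most three integer lengths.\<close>

definition unit_cost :: nat where
  "unit_cost = 1 + 9 * int_len M"

text \<open>Total correctness with a budget of \<open>N\<close> instructions. The configuration
  comes last so that \<open>wp c N Q\<close> can serve as a postcondition.\<close>

definition wp :: "com \<Rightarrow> nat \<Rightarrow> (config \<Rightarrow> bool) \<Rightarrow> config \<Rightarrow> bool" where
  "wp c N Q \<sigma> \<longleftrightarrow> (\<exists>t \<tau>. exec c \<sigma> t \<tau> \<and> t \<le> N * unit_cost \<and> Q \<tau>)"

lemma int_len_le: "\<bar>x\<bar> \<le> M \<Longrightarrow> int_len x \<le> int_len M"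
  by (rule int_len_mono) simp

lemma bdd_abs_le: "bdd s \<Longrightarrow> \<bar>s r\<bar> \<le> M"
  by (simp add: bdd_def)

lemma bdd_upd: "bdd s \<Longrightarrow> \<bar>v\<bar> \<le> M \<Longrightarrow> bdd (s(r := v))"
  by (simp add: bdd_def)

lemma operand_cost_le: "bdd s \<Longrightarrow> op_ok a \<Longrightarrow> operand_cost s a \<le> 3 * int_len M"
  \<comment> \<open>The incomplete \<open>case\<close> expressions merely name the register of an
    operand that has one.\<close>
  using int_len_le[of "operand_val s a"] int_len_le[of "s (case a of Ind r \<Rightarrow> r | Reg r \<Rightarrow> r)"]
    int_len_le[of "int (case a of Ind r \<Rightarrow> r | Reg r \<Rightarrow> r)"]
  by (cases a) (auto simp: bdd_def)

lemma dest_cost_le: "bdd s \<Longrightarrow> dest_ok d \<Longrightarrow> dest_cost s d \<le> 3 * int_len M"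
  using int_len_le[of "s (case d of To_Ind r \<Rightarrow> r)"]
    int_len_le[of "int (case d of To_Ind r \<Rightarrow> r | To_Reg r \<Rightarrow> r)"]
  by (cases d) (auto simp: bdd_def)

section \<open>Proof rules with instruction budgets\<close>

lemma wp_mono: "wp c N Q \<sigma> \<Longrightarrow> N \<le> N' \<Longrightarrow> (\<And>\<tau>. Q \<tau> \<Longrightarrow> Q' \<tau>) \<Longrightarrow> wp c N' Q' \<sigma>"
  unfolding wp_def by (meson le_trans mult_le_mono1)

text \<open>The bound on the result makes the new memory bounded, and the continuation receives this
  as a premise. So proofs about longer programs carry boundedness along.\<close>

lemma wp_Arith:
  assumes "bdd s" "op_ok a" "op_ok b" "dest_ok d"
    and "\<bar>arith f (operand_val s a) (operand_val s b)\<bar> \<le> M"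
    and "bdd (s(dest_addr s d := arith f (operand_val s a) (operand_val s b))) \<Longrightarrow>
      Q (s(dest_addr s d := arith f (operand_val s a) (operand_val s b)), inp, out)"
  shows "wp (Arith d f a b) 1 Q (s, inp, out)"
proof -
  have "1 + operand_cost s a + operand_cost s b + dest_cost s d \<le> unit_cost"
    using operand_cost_le[OF assms(1,2)] operand_cost_le[OF assms(1,3)]
      dest_cost_le[OF assms(1,4)] by (simp add: unit_cost_def)
  then show ?thesis
    unfolding wp_def using exec.Arith assms(6)[OF bdd_upd[OF assms(1,5)]] by fastforce
qed

lemma wp_Read:
  assumes "bdd s" "dest_ok d" "\<bar>x\<bar> \<le> M"
    and "bdd (s(dest_addr s d := x)) \<Longrightarrow> Q (s(dest_addr s d := x), inp, out)"
  shows "wp (Read d) 1 Q (s, x # inp, out)"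
proof -
  have "1 + int_len x + dest_cost s d \<le> unit_cost"
    using dest_cost_le[OF assms(1,2)] int_len_le[OF assms(3)] by (simp add: unit_cost_def)
  then show ?thesis
    unfolding wp_def using exec.Read assms(4)[OF bdd_upd[OF assms(1,3)]] by fastforce
qed

lemma wp_Write:
  assumes "bdd s" "op_ok a" "Q (s, inp, out @ [operand_val s a])"
  shows "wp (Write a) 1 Q (s, inp, out)"
proof -
  have "1 + operand_cost s a \<le> unit_cost"
    using operand_cost_le[OF assms(1,2)] by (simp add: unit_cost_def)
  then show ?thesis
    unfolding wp_def using exec.Write assms(3) by fastforce
qed

lemma wp_Seq:
  assumes "wp c\<^sub>1 N\<^sub>1 (wp c\<^sub>2 N\<^sub>2 Q) \<sigma>"
  shows "wp (Seq c\<^sub>1 c\<^sub>2) (N\<^sub>1 + N\<^sub>2) Q \<sigma>"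
  using assms unfolding wp_def
  by (metis (no_types, lifting) add_mono add_mult_distrib exec.Seq)

lemma wp_If:
  assumes "bdd s" "op_ok a"
    and "operand_val s a > 0 \<Longrightarrow> wp c\<^sub>1 N Q (s, inp, out)"
    and "\<not> operand_val s a > 0 \<Longrightarrow> wp c\<^sub>2 N Q (s, inp, out)"
  shows "wp (If_Pos a c\<^sub>1 c\<^sub>2) (1 + N) Q (s, inp, out)"
proof -
  have *: "1 + operand_cost s a \<le> unit_cost"
    using operand_cost_le[OF assms(1,2)] by (simp add: unit_cost_def)
  show ?thesis
  proof (cases "operand_val s a > 0")
    case True
    then obtain t \<tau> where "exec c\<^sub>1 (s, inp, out) t \<tau>" "t \<le> N * unit_cost" "Q \<tau>"
      using assms(3) unfolding wp_def by blast
    with True * show ?thesis unfolding wp_def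
      by (intro exI[of _ "1 + operand_cost s a + t"] exI[of _ \<tau>]) (auto intro: exec.If_True[simplified])
  next
    case False
    then obtain t \<tau> where "exec c\<^sub>2 (s, inp, out) t \<tau>" "t \<le> N * unit_cost" "Q \<tau>"
      using assms(4) unfolding wp_def by blast
    with False * show ?thesis unfolding wp_def
      by (intro exI[of _ "1 + operand_cost s a + t"] exI[of _ \<tau>]) (auto intro: exec.If_False[simplified])
  qed
qed

text \<open>The invariant is indexed by the number of iterations left, which is the value of the
  guard; this gives termination. Each round pays for one guard test, and a last test ends the
  loop.\<close>

lemma wp_countdown:
  assumes inv: "\<And>i s inp out. I i (s, inp, out) \<Longrightarrow> operand_val s a = int i \<and> bdd s"
    and "op_ok a"
    and body: "\<And>i \<sigma>. i < n \<Longrightarrow> I (Suc i) \<sigma> \<Longrightarrow> wp c N (I i) \<sigma>"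
    and "I n \<sigma>"
  shows "wp (While_Pos a c) (n * (N + 1) + 1) (I 0) \<sigma>"
proof -
  have "wp (While_Pos a c) (k * (N + 1) + 1) (I 0) \<sigma>" if "k \<le> n" "I k \<sigma>" for k \<sigma>
    using that
  proof (induction k arbitrary: \<sigma>)
    case 0
    obtain s inp out where \<sigma>: "\<sigma> = (s, inp, out)" by (cases \<sigma>)
    with 0 inv have "operand_val s a = 0" "bdd s" by fastforce+
    moreover from this have "1 + operand_cost s a \<le> unit_cost"
      using operand_cost_le \<open>op_ok a\<close> by (fastforce simp: unit_cost_def)
    ultimately show ?case
      unfolding wp_def using 0 exec.While_False[of s a c inp out] \<sigma> by fastforce
  next
    case (Suc k)
    obtain s inp out where \<sigma>: "\<sigma> = (s, inp, out)" by (cases \<sigma>)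
    with Suc.prems inv have s: "operand_val s a > 0" "bdd s" by fastforce+
    then have cost: "1 + operand_cost s a \<le> unit_cost"
      using operand_cost_le \<open>op_ok a\<close> by (fastforce simp: unit_cost_def)
    from body[of k \<sigma>] Suc.prems obtain t\<^sub>1 \<sigma>' where
      1: "exec c \<sigma> t\<^sub>1 \<sigma>'" "t\<^sub>1 \<le> N * unit_cost" "I k \<sigma>'"
      unfolding wp_def by auto
    from Suc.IH[OF _ 1(3)] Suc.prems obtain t\<^sub>2 \<tau> where
      2: "exec (While_Pos a c) \<sigma>' t\<^sub>2 \<tau>" "t\<^sub>2 \<le> (k * (N + 1) + 1) * unit_cost" "I 0 \<tau>"
      unfolding wp_def by auto
    have "exec (While_Pos a c) \<sigma> (1 + operand_cost s a + t\<^sub>1 + t\<^sub>2) \<tau>"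
      using exec.While_True[OF s(1)] 1(1) 2(1) unfolding \<sigma> by blast
    moreover have "1 + operand_cost s a + t\<^sub>1 + t\<^sub>2 \<le> (Suc k * (N + 1) + 1) * unit_cost"
      using cost 1(2) 2(2) by (simp add: algebra_simps)
    ultimately show ?case
      unfolding wp_def using 2(3) by blast
  qed
  with \<open>I n \<sigma>\<close> show ?thesis by simp
qed

lemma wp_skip: "bdd s \<Longrightarrow> Q (s, inp, out) \<Longrightarrow> wp skip 1 Q (s, inp, out)"
  unfolding skip_def using M_pos bdd_abs_le[of s 0] by (intro wp_Arith) auto

lemma wp_writes:
  assumes "bdd s" "\<forall>a\<in>set as. op_ok a" "Q (s, inp, out @ map (operand_val s) as)"
  shows "wp (seqs (map Write as)) (length as + 1) Q (s, inp, out)"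
  using assms(2,3)
proof (induction as arbitrary: out)
  case Nil
  with \<open>bdd s\<close> show ?case by (simp add: wp_skip[simplified])
next
  case (Cons a as)
  then have "wp (Seq (Write a) (seqs (map Write as))) (1 + (length as + 1)) Q (s, inp, out)"
    using \<open>bdd s\<close> by (intro wp_Seq wp_Write) auto
  then show ?case by simp
qed

text \<open>As \<open>1 \<le> X\<close>, the bound on the final product also bounds all intermediate
  products.\<close>

lemma wp_power:
  assumes "bdd s" "int r \<le> M" "int q \<le> M" "r \<noteq> q" "\<bar>s q\<bar> \<le> X" "1 \<le> X" "\<bar>s r\<bar> * X ^ k \<le> M"
    and "bdd (s(r := s r * s q ^ k)) \<Longrightarrow> Q (s(r := s r * s q ^ k), inp, out)"
  shows "wp (seqs (replicate k (Arith (To_Reg r) Times (Reg r) (Reg q)))) (k + 1) Q (s, inp, out)"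
  using assms(1,5,7,8)
proof (induction k arbitrary: s)
  case 0
  then show ?case by (simp add: wp_skip[simplified])
next
  case (Suc k)
  let ?s = "s(r := s r * s q)"
  have le: "\<bar>s r * s q\<bar> * X ^ k \<le> M"
  proof -
    have "\<bar>s r * s q\<bar> * X ^ k \<le> (\<bar>s r\<bar> * X) * X ^ k"
      unfolding abs_mult using Suc.prems(2) \<open>1 \<le> X\<close> by (intro mult_right_mono mult_left_mono) auto
    with Suc.prems(3) show ?thesis by (simp add: mult_ac)
  qed
  moreover have "\<bar>s r * s q\<bar> \<le> \<bar>s r * s q\<bar> * X ^ k"
    using \<open>1 \<le> X\<close> by (simp add: mult_le_cancel_left1 one_le_power)
  ultimately have le': "\<bar>s r * s q\<bar> \<le> M" by linarith
  have eq: "?s(r := ?s r * ?s q ^ k) = s(r := s r * s q ^ Suc k)"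
    using \<open>r \<noteq> q\<close> by (auto simp: mult_ac)
  have "wp (Seq (Arith (To_Reg r) Times (Reg r) (Reg q))
      (seqs (replicate k (Arith (To_Reg r) Times (Reg r) (Reg q))))) (1 + (k + 1)) Q (s, inp, out)"
  proof (intro wp_Seq wp_Arith)
    have "wp (seqs (replicate k (Arith (To_Reg r) Times (Reg r) (Reg q)))) (k + 1) Q (?s, inp, out)"
    proof (rule Suc.IH[of ?s])
      show "Q (?s(r := ?s r * ?s q ^ k), inp, out)" if "bdd (?s(r := ?s r * ?s q ^ k))"
        using that Suc.prems(4) unfolding eq by blast
      show "bdd ?s" by (rule bdd_upd[OF Suc.prems(1) le'])
      show "\<bar>?s q\<bar> \<le> X" using Suc.prems(2) \<open>r \<noteq> q\<close> by simp
      show "\<bar>?s r\<bar> * X ^ k \<le> M" using le by simp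
    qed
    then show "wp (seqs (replicate k (Arith (To_Reg r) Times (Reg r) (Reg q)))) (k + 1) Q
      (s(dest_addr s (To_Reg r) := arith Times (operand_val s (Reg r)) (operand_val s (Reg q))), inp, out)"
      by simp
  qed (use assms Suc.prems le' in auto)
  then show ?case by simp
qed

end

section \<open>The reduction program\<close>

text \<open>Register use: 1 counts the rows, 2 holds the number of columns, 3 the address preceding the
  current row, 4 the address preceding the target, 5 the negated target entry, 6 the threshold; 7, 8 and
  9 are scratch.  For the factor chosen when \<open>k\<close> more remain, \<open>10 + 3k\<close> and \<open>11 + 3k\<close> hold the encodings of
  the positive and negative literal.  \<open>12 + 3k\<close> holds the product of the coefficients when \<open>k\<close> factors
  remain.  The input data start at \<open>13 + 3p\<close>.\<close>

definition leaf :: "nat list \<Rightarrow> com" where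
  "leaf ls = If_Pos (Reg 12)
     (Seq (seqs (map Write ([Reg 12] @ map (\<lambda>l. Reg (11 + 3 * l)) ls @ [Const 0])))
       (Arith (To_Reg 6) Plus (Reg 6) (Reg 12)))
     (Seq (Arith (To_Reg 7) Minus (Const 0) (Reg 12))
       (Seq (seqs (map Write (concat (map (\<lambda>k. [Reg 7] @ map (\<lambda>l. Reg (11 + 3 * l)) (take k ls) @
            [Reg (10 + 3 * ls ! k), Const 0]) [0..<length ls]))))
         (Seq (Arith (To_Reg 7) Times (Reg 7) (Const (int (length ls) - 1)))
           (Arith (To_Reg 6) Plus (Reg 6) (Reg 7)))))"

text \<open>\<open>ls\<close> lists the levels at which a variable, not the constant, was picked. It
  is known when the program is built, so the two recursive calls give \<open>2 ^ p\<close> leaves, a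
  constant for fixed \<open>p\<close>. A loop counter runs from \<open>n\<close> to 1 and is thus
  the encoded positive literal itself, as well as the offset from the address preceding the
  row.\<close>

fun gen :: "nat \<Rightarrow> nat list \<Rightarrow> com" where
  "gen 0 ls = leaf ls"
| "gen (Suc k) ls =
     Seq (Arith (To_Reg (10 + 3 * k)) Plus (Reg 2) (Const 0))
       (Seq (While_Pos (Reg (10 + 3 * k))
         (Seq (Arith (To_Reg 8) Plus (Reg 3) (Reg (10 + 3 * k)))
           (Seq (Arith (To_Reg (11 + 3 * k)) Minus (Const 0) (Reg (10 + 3 * k)))
             (Seq (Arith (To_Reg (12 + 3 * k)) Times (Reg (15 + 3 * k)) (Ind 8))
               (Seq (gen k (ls @ [k]))
                 (Arith (To_Reg (10 + 3 * k)) Minus (Reg (10 + 3 * k)) (Const 1)))))))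
         (Seq (Arith (To_Reg (12 + 3 * k)) Times (Reg (15 + 3 * k)) (Reg 5))
           (gen k ls)))"

text \<open>A leaf writes at most \<open>p\<close> clauses of at most \<open>p + 3\<close> numbers
  each. The sums are left unsimplified, shaped like the program, so that they match
  \<open>wp_Seq\<close>.\<close>

fun gen_time :: "nat \<Rightarrow> nat \<Rightarrow> nat \<Rightarrow> nat" where
  "gen_time p n 0 = p * (p + 3) + 10"
| "gen_time p n (Suc k) = 1 + (n * ((1 + (1 + (1 + (gen_time p n k + 1)))) + 1) + 1 + (1 + gen_time p n k))"

text \<open>Running \<open>gen k\<close> may alter the threshold, the scratch registers 7 and 8, and
  the registers of the levels below \<open>k\<close>.\<close>

definition frame :: "nat \<Rightarrow> mem \<Rightarrow> mem \<Rightarrow> bool" where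
  "frame k s s' \<longleftrightarrow> (\<forall>r. 10 + 3 * k \<le> r \<or> r < 10 \<and> r \<notin> {6, 7, 8} \<longrightarrow> s' r = s r)"

section \<open>Correctness of the expansion of one row\<close>

locale row_expansion = machine +
  fixes p n a :: nat and coef :: "nat \<Rightarrow> int" and t X :: int
  assumes regs: "int (13 + 3 * p) \<le> M"
    and data_lower: "13 + 3 * p \<le> a + 1"
    and data_upper: "int (a + n) \<le> M"
    and X_pos: "1 \<le> X"
    and row_bound: "\<And>j. j < n \<Longrightarrow> \<bar>coef j\<bar> \<le> X"
    and t_bound: "\<bar>t\<bar> \<le> X"
begin

text \<open>\<open>g l\<close> is the variable picked at level \<open>l\<close>. The last conjunct
  leaves room for \<open>k\<close> more multiplications by numbers of size at most
  \<open>X\<close>.\<close>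

definition pre :: "nat \<Rightarrow> nat list \<Rightarrow> (nat \<Rightarrow> nat) \<Rightarrow> mem \<Rightarrow> bool" where
  "pre k ls g s \<longleftrightarrow> bdd s \<and> s 2 = int n \<and> s 3 = int a \<and> s 5 = - t \<and>
     (\<forall>j<n. s (a + j + 1) = coef j) \<and> k + length ls \<le> p \<and>
     (\<forall>l\<in>set ls. k \<le> l \<and> l < p \<and> s (10 + 3 * l) = int (g l) + 1 \<and> s (11 + 3 * l) = - (int (g l) + 1)) \<and>
     \<bar>s (12 + 3 * k)\<bar> * X ^ k \<le> M"

definition post :: "nat \<Rightarrow> (int \<times> nat list) list \<Rightarrow> mem \<Rightarrow> int list \<Rightarrow> int list \<Rightarrow> config \<Rightarrow> bool" where
  "post k ts s inp out \<tau> \<longleftrightarrow> (\<exists>s'. \<tau> = (s', inp, out @ encode_terms ts) \<and> bdd s' \<and>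
     s' 6 = s 6 + const_sum ts \<and> frame k s s')"

text \<open>For a nonpositive coefficient, register 7 first holds the common clause weight and is
  then multiplied by \<open>length ls - 1\<close> to become \<open>term_const\<close>.\<close>

lemma leaf_correct:
  assumes pre: "pre 0 ls g s"
    and bound: "\<bar>s 6\<bar> + \<bar>term_const (s 12, map g ls)\<bar> \<le> M"
  shows "wp (leaf ls) (gen_time p n 0) (post 0 [(s 12, map g ls)] s inp out) (s, inp, out)"
proof -
  have "bdd s" and len: "length ls \<le> p"
    and ls: "\<And>l. l \<in> set ls \<Longrightarrow> l < p \<and> s (10 + 3 * l) = int (g l) + 1 \<and> s (11 + 3 * l) = - (int (g l) + 1)"
    using pre unfolding pre_def by auto
  have ls_ok: "int (10 + 3 * l) \<le> M \<and> int (11 + 3 * l) \<le> M" if "l \<in> set ls" for l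
    using ls[OF that] regs by linarith
  show ?thesis
  proof (cases "s 12 > 0")
    case True
    let ?ops = "[Reg 12] @ map (\<lambda>l. Reg (11 + 3 * l)) ls @ [Const 0]"
    have out: "map (operand_val s) ?ops = encode_terms [(s 12, map g ls)]"
      using True ls by (simp add: encode_terms_def encode_wclause_def)
    have "wp (leaf ls) (1 + ((length ?ops + 1) + 1)) (post 0 [(s 12, map g ls)] s inp out) (s, inp, out)"
      unfolding leaf_def
    proof (rule wp_If)
      show "wp (Seq (seqs (map Write ?ops)) (Arith (To_Reg 6) Plus (Reg 6) (Reg 12)))
          (length ?ops + 1 + 1) (post 0 [(s 12, map g ls)] s inp out) (s, inp, out)"
      proof (intro wp_Seq wp_writes wp_Arith)
        show "\<forall>a\<in>set ?ops. op_ok a"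
          using ls_ok regs M_pos by auto
        show "\<bar>arith Plus (operand_val s (Reg 6)) (operand_val s (Reg 12))\<bar> \<le> M"
          using bound True by simp
      qed (use \<open>bdd s\<close> regs out True in \<open>auto simp: post_def frame_def const_sum_def\<close>)
    qed (use \<open>bdd s\<close> regs True in auto)
    then show ?thesis
      by (rule wp_mono) (use len in \<open>auto simp: algebra_simps\<close>)
  next
    case False
    define ops where "ops = concat (map (\<lambda>k. [Reg 7] @ map (\<lambda>l. Reg (11 + 3 * l)) (take k ls) @
      [Reg (10 + 3 * ls ! k), Const 0]) [0..<length ls])"
    let ?s = "s(7 := - s 12)"
    have "map (operand_val ?s) ops = concat (map (\<lambda>k. - s 12 # map (\<lambda>l. - (int (g l) + 1)) (take k ls) @
        [int (g (ls ! k)) + 1, 0]) [0..<length ls])"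
      unfolding ops_def map_concat map_map
      by (intro arg_cong[where f = concat] map_cong) (auto simp: ls dest!: in_set_takeD)
    also have "\<dots> = encode_terms [(s 12, map g ls)]"
      using False unfolding encode_terms_def
      by (auto simp: encode_wclause_def take_map intro!: arg_cong[where f = concat])
    finally have out: "map (operand_val ?s) ops = encode_terms [(s 12, map g ls)]" .
    \<comment> \<open>Clause \<open>k\<close> is written as the weight, \<open>k\<close> negative
      literals, one positive literal and the terminating zero.\<close>
    have "length ops = (\<Sum>k\<leftarrow>[0..<length ls]. k + 3)"
      by (auto simp: ops_def length_concat o_def intro!: arg_cong[where f = sum_list])
    also have "\<dots> \<le> (\<Sum>k\<leftarrow>[0..<length ls]. p + 3)"
      using len by (intro sum_list_mono) auto
    also have "\<dots> \<le> p * (p + 3)"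
      using len by (simp add: sum_list_triv mult_le_mono1)
    finally have "length ops \<le> p * (p + 3)" .
    have "wp (leaf ls) (1 + (1 + ((length ops + 1) + (1 + 1)))) (post 0 [(s 12, map g ls)] s inp out) (s, inp, out)"
      unfolding leaf_def ops_def[symmetric]
    proof (rule wp_If)
      show "wp (Seq (Arith (To_Reg 7) Minus (Const 0) (Reg 12)) (Seq (seqs (map Write ops))
         (Seq (Arith (To_Reg 7) Times (Reg 7) (Const (int (length ls) - 1)))
           (Arith (To_Reg 6) Plus (Reg 6) (Reg 7)))))
          (1 + ((length ops + 1) + (1 + 1))) (post 0 [(s 12, map g ls)] s inp out) (s, inp, out)"
      proof (rule wp_Seq, rule wp_Arith)
        assume "bdd (s(dest_addr s (To_Reg 7) := arith Minus (operand_val s (Const 0)) (operand_val s (Reg 12))))"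
        then have "bdd ?s" by simp
        have "wp (Seq (seqs (map Write ops))
           (Seq (Arith (To_Reg 7) Times (Reg 7) (Const (int (length ls) - 1)))
             (Arith (To_Reg 6) Plus (Reg 6) (Reg 7))))
            ((length ops + 1) + (1 + 1)) (post 0 [(s 12, map g ls)] s inp out) (?s, inp, out)"
        proof (rule wp_Seq, rule wp_writes[OF \<open>bdd ?s\<close>])
          show "\<forall>a\<in>set ops. op_ok a"
            using ls_ok regs M_pos by (auto simp: ops_def dest!: in_set_takeD)
          show "wp (Seq (Arith (To_Reg 7) Times (Reg 7) (Const (int (length ls) - 1)))
               (Arith (To_Reg 6) Plus (Reg 6) (Reg 7)))
            (1 + 1) (post 0 [(s 12, map g ls)] s inp out) (?s, inp, out @ map (operand_val ?s) ops)"
          proof (intro wp_Seq wp_Arith)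
            show "op_ok (Const (int (length ls) - 1))"
              using len regs by simp
            show "\<bar>arith Times (operand_val ?s (Reg 7)) (operand_val ?s (Const (int (length ls) - 1)))\<bar> \<le> M"
              using bound False by simp
          qed (use \<open>bdd ?s\<close> regs bound False in \<open>auto simp: out post_def frame_def const_sum_def\<close>)
        qed
        then show "wp (Seq (seqs (map Write ops))
           (Seq (Arith (To_Reg 7) Times (Reg 7) (Const (int (length ls) - 1)))
             (Arith (To_Reg 6) Plus (Reg 6) (Reg 7))))
            ((length ops + 1) + (1 + 1)) (post 0 [(s 12, map g ls)] s inp out)
            (s(dest_addr s (To_Reg 7) := arith Minus (operand_val s (Const 0)) (operand_val s (Reg 12))), inp, out)"
          by simp
      qed (use \<open>bdd s\<close> regs bdd_abs_le[OF \<open>bdd s\<close>, of 12] in auto)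
    qed (use \<open>bdd s\<close> regs False in auto)
    then show ?thesis
      by (rule wp_mono) (use \<open>length ops \<le> p * (p + 3)\<close> in auto)
  qed
qed

text \<open>Induction on the number of remaining factors: the loop writes the terms for each picked
  variable, the code after it those for the constant. The budget for register 6 uses absolute values
  to cover all intermediate thresholds.\<close>

lemma gen_correct:
  assumes "k \<le> p" "pre k ls g s"
    and "\<bar>s 6\<bar> + const_abs_sum (terms n coef t k (s (12 + 3 * k)) (map g ls)) \<le> M"
  shows "wp (gen k ls) (gen_time p n k)
    (post k (terms n coef t k (s (12 + 3 * k)) (map g ls)) s inp out) (s, inp, out)"
  using assms
proof (induction k arbitrary: ls g s out)
  case 0
  then show ?case using leaf_correct[of ls g s inp out] by (simp add: const_abs_sum_def)
next
  case (Suc k)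
  let ?P = "s (15 + 3 * k)"
  let ?f = "\<lambda>j. terms n coef t k (?P * coef j) (map g ls @ [j])"
  let ?done = "\<lambda>i. concat (map ?f (rev [i..<n]))"
  let ?todo = "\<lambda>i. concat (map ?f (rev [0..<i]))"
  let ?last = "terms n coef t k (?P * - t) (map g ls)"
  \<comment> \<open>With \<open>i\<close> rounds left, the variables from \<open>n - 1\<close> down
    to \<open>i\<close> have been handled.\<close>
  define I where "I i \<tau> \<longleftrightarrow> (\<exists>s'. \<tau> = (s', inp, out @ encode_terms (?done i)) \<and> bdd s' \<and>
     s' 6 = s 6 + const_sum (?done i) \<and> frame (Suc k) s s' \<and> s' (10 + 3 * k) = int i)" for i \<tau>
  have P: "\<bar>?P\<bar> * X ^ Suc k \<le> M"
    using Suc.prems(2) by (simp add: pre_def)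
  have prod: "\<bar>?P * x\<bar> * X ^ k \<le> M" "\<bar>?P * x\<bar> \<le> M" if "\<bar>x\<bar> \<le> X" for x
  proof -
    have "\<bar>?P * x\<bar> * X ^ k \<le> (\<bar>?P\<bar> * X) * X ^ k"
      unfolding abs_mult using that X_pos by (intro mult_right_mono mult_left_mono) auto
    with P show *: "\<bar>?P * x\<bar> * X ^ k \<le> M" by (simp add: mult_ac)
    have "\<bar>?P * x\<bar> \<le> \<bar>?P * x\<bar> * X ^ k"
      using X_pos by (simp add: mult_le_cancel_left1 one_le_power)
    with * show "\<bar>?P * x\<bar> \<le> M" by linarith
  qed
  have split_done: "?done i = ?done (Suc i) @ ?f i" if "i < n" for i
    using that by (simp add: upt_conv_Cons)
  have total: "const_abs_sum (?done i) + const_abs_sum (?todo i) = const_abs_sum (?todo n)" if "i \<le> n" for i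
  proof -
    have "[0..<n] = [0..<i] @ [i..<n]" using that by (metis le_add_diff_inverse upt_add_eq_append zero_le)
    then show ?thesis by simp
  qed
  have budget: "\<bar>s 6\<bar> + const_abs_sum (?todo n) + const_abs_sum ?last \<le> M"
    using Suc.prems(3) by (simp add: add.assoc)
  have k: "int (15 + 3 * k) \<le> M"
    using Suc.prems(1) regs by linarith
  note s = Suc.prems(2)[unfolded pre_def]
  let ?ts = "terms n coef t (Suc k) (s (12 + 3 * Suc k)) (map g ls)"
  have ts: "?ts = ?todo n @ ?last" by (simp add: ac_simps)
  have I_regs: "s' 2 = int n" "s' 3 = int a" "s' 5 = - t" "s' (15 + 3 * k) = ?P"
      "\<And>j. j < n \<Longrightarrow> s' (a + j + 1) = coef j"
      "\<And>l. l \<in> set ls \<Longrightarrow> Suc k \<le> l \<and> l < p \<and> s' (10 + 3 * l) = int (g l) + 1 \<and> s' (11 + 3 * l) = - (int (g l) + 1)"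
    if "frame (Suc k) s s'" for s'
    using that s data_lower Suc.prems(1) unfolding frame_def by auto
  \<comment> \<open>The finished part has moved the threshold by at most its absolute sum, so the
    rest of the budget is still available.\<close>
  have I_budget: "\<bar>s' 6\<bar> + const_abs_sum (?todo i) + const_abs_sum ?last \<le> M"
    if "s' 6 = s 6 + const_sum (?done i)" "i \<le> n" for s' :: mem and i
    using that total[of i] budget abs_const_sum_le[of "?done i"] by linarith
  let ?body = "Seq (Arith (To_Reg 8) Plus (Reg 3) (Reg (10 + 3 * k)))
           (Seq (Arith (To_Reg (11 + 3 * k)) Minus (Const 0) (Reg (10 + 3 * k)))
             (Seq (Arith (To_Reg (12 + 3 * k)) Times (Reg (15 + 3 * k)) (Ind 8))
               (Seq (gen k (ls @ [k]))
                 (Arith (To_Reg (10 + 3 * k)) Minus (Reg (10 + 3 * k)) (Const 1)))))"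
  have body: "wp ?body
      (1 + (1 + (1 + (gen_time p n k + 1)))) (I i) \<sigma>" if "i < n" "I (Suc i) \<sigma>" for i \<sigma>
  proof -
    from that(2) obtain s' where \<sigma>: "\<sigma> = (s', inp, out @ encode_terms (?done (Suc i)))"
      and "bdd s'" and thr: "s' 6 = s 6 + const_sum (?done (Suc i))"
      and fr: "frame (Suc k) s s'" and cnt: "s' (10 + 3 * k) = int (Suc i)"
      unfolding I_def by blast
    note s' = I_regs[OF fr]
    let ?s1 = "s'(8 := int (a + i + 1))"
    let ?s2 = "?s1(11 + 3 * k := - int (Suc i))"
    let ?s3 = "?s2(12 + 3 * k := ?P * coef i)"
    let ?out = "out @ encode_terms (?done (Suc i))"
    have coef: "\<bar>coef i\<bar> \<le> X" using row_bound that(1) .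
    have bnds: "int (a + i + 1) \<le> M" "int (Suc i) \<le> M"
      using data_upper that(1) by linarith+
    have b1: "bdd ?s1" using \<open>bdd s'\<close> bnds by (intro bdd_upd) auto
    have b2: "bdd ?s2" using bnds by (intro bdd_upd[OF b1]) auto
    have b3: "bdd ?s3" using prod[OF coef] by (intro bdd_upd[OF b2]) auto
    have fr3: "frame (Suc k) s ?s3"
      using fr unfolding frame_def by auto
    have todo: "?todo (Suc i) = ?f i @ ?todo i" by simp
    have pre: "pre k (ls @ [k]) (g(k := i)) ?s3"
      unfolding pre_def using I_regs[OF fr3] b3 cnt prod[OF coef] s Suc.prems(1) by auto
    \<comment> \<open>All levels in \<open>ls\<close> are above \<open>k\<close>, so updating
      \<open>g\<close> at \<open>k\<close> keeps the earlier picks.\<close>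
    have map_g: "map (g(k := i)) (ls @ [k]) = map g ls @ [i]"
      using s by auto
    have P3: "?s3 (12 + 3 * k) = ?P * coef i" by simp
    have thr3: "\<bar>?s3 6\<bar> + const_abs_sum (?f i) \<le> M"
      using I_budget[of s' "Suc i", OF thr] that(1) todo const_abs_sum_nonneg[of "?todo i"]
        const_abs_sum_nonneg[of "?last"] by simp
    have gen: "wp (gen k (ls @ [k])) (gen_time p n k) (post k (?f i) ?s3 inp ?out) (?s3, inp, ?out)"
      by (rule Suc.IH[OF _ pre, unfolded map_g P3]) (use thr3 Suc.prems(1) in simp_all)
    have last: "wp (Arith (To_Reg (10 + 3 * k)) Minus (Reg (10 + 3 * k)) (Const 1)) 1 (I i) \<tau>"
      if "post k (?f i) ?s3 inp ?out \<tau>" for \<tau>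
    proof -
      from that obtain u where \<tau>: "\<tau> = (u, inp, ?out @ encode_terms (?f i))" and "bdd u"
        and u6: "u 6 = s' 6 + const_sum (?f i)" and fru: "frame k ?s3 u"
        unfolding post_def by auto
      have u10: "u (10 + 3 * k) = int (Suc i)"
        using fru cnt unfolding frame_def by auto
      have "frame (Suc k) s u"
        using fru fr3 unfolding frame_def by auto
      then show ?thesis
        unfolding \<tau> using \<open>bdd u\<close> k M_pos u10 u6 thr split_done[OF \<open>i < n\<close>] bnds
        by (intro wp_Arith) (auto simp: I_def frame_def)
    qed
    \<comment> \<open>The data lie above all working registers, so the matrix entry has not been
      overwritten.\<close>
    have ind: "operand_val ?s2 (Ind 8) = coef i"
    proof -
      have "?s2 8 = int (a + i + 1)" by simp
      then have "operand_val ?s2 (Ind 8) = ?s2 (a + i + 1)"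
        by (simp only: operand_val.simps nat_int)
      then show ?thesis
        using s'(5)[OF that(1)] data_lower Suc.prems(1) by auto
    qed
    show ?thesis
      unfolding \<sigma>
    proof (rule wp_Seq, rule wp_Arith[OF \<open>bdd s'\<close>])
      have e1: "s'(dest_addr s' (To_Reg 8) := arith Plus (operand_val s' (Reg 3)) (operand_val s' (Reg (10 + 3 * k)))) = ?s1"
        using s'(2) cnt by (simp add: ac_simps)
      have e2: "?s1(dest_addr ?s1 (To_Reg (11 + 3 * k)) := arith Minus (operand_val ?s1 (Const 0))
           (operand_val ?s1 (Reg (10 + 3 * k)))) = ?s2"
        using cnt by simp
      have e3: "?s2(dest_addr ?s2 (To_Reg (12 + 3 * k)) := arith Times (operand_val ?s2 (Reg (15 + 3 * k)))
           (operand_val ?s2 (Ind 8))) = ?s3"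
        unfolding arith.simps dest_addr.simps ind using s'(4) by simp
      show "wp (Seq (Arith (To_Reg (11 + 3 * k)) Minus (Const 0) (Reg (10 + 3 * k)))
             (Seq (Arith (To_Reg (12 + 3 * k)) Times (Reg (15 + 3 * k)) (Ind 8))
               (Seq (gen k (ls @ [k]))
                 (Arith (To_Reg (10 + 3 * k)) Minus (Reg (10 + 3 * k)) (Const 1)))))
        (1 + (1 + (gen_time p n k + 1))) (I i)
        (s'(dest_addr s' (To_Reg 8) := arith Plus (operand_val s' (Reg 3)) (operand_val s' (Reg (10 + 3 * k)))), inp, ?out)"
        unfolding e1
      proof (rule wp_Seq, rule wp_Arith[OF b1])
        show "wp (Seq (Arith (To_Reg (12 + 3 * k)) Times (Reg (15 + 3 * k)) (Ind 8))
               (Seq (gen k (ls @ [k]))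
                 (Arith (To_Reg (10 + 3 * k)) Minus (Reg (10 + 3 * k)) (Const 1))))
          (1 + (gen_time p n k + 1)) (I i)
          (?s1(dest_addr ?s1 (To_Reg (11 + 3 * k)) := arith Minus (operand_val ?s1 (Const 0))
           (operand_val ?s1 (Reg (10 + 3 * k)))), inp, ?out)"
          unfolding e2
        proof (rule wp_Seq, rule wp_Arith[OF b2])
          show "wp (Seq (gen k (ls @ [k]))
                 (Arith (To_Reg (10 + 3 * k)) Minus (Reg (10 + 3 * k)) (Const 1)))
            (gen_time p n k + 1) (I i)
            (?s2(dest_addr ?s2 (To_Reg (12 + 3 * k)) := arith Times (operand_val ?s2 (Reg (15 + 3 * k)))
              (operand_val ?s2 (Ind 8))), inp, ?out)"
            unfolding e3 by (rule wp_Seq, rule wp_mono[OF gen]) (use last in auto)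
          show "\<bar>arith Times (operand_val ?s2 (Reg (15 + 3 * k))) (operand_val ?s2 (Ind 8))\<bar> \<le> M"
            unfolding arith.simps ind using s'(4) prod[OF coef] by simp
        qed (use k in auto)
      qed (use k cnt bnds M_pos in auto)
    qed (use k s'(2) cnt bnds in auto)
  qed
  \<comment> \<open>The remaining case, where the constant is picked; register 5 already holds
    \<open>- t\<close>.\<close>
  have final: "wp (Seq (Arith (To_Reg (12 + 3 * k)) Times (Reg (15 + 3 * k)) (Reg 5)) (gen k ls))
      (1 + gen_time p n k) (post (Suc k) ?ts s inp out) \<tau>" if "I 0 \<tau>" for \<tau>
  proof -
    from that obtain s' where \<tau>: "\<tau> = (s', inp, out @ encode_terms (?done 0))"
      and "bdd s'" and thr: "s' 6 = s 6 + const_sum (?done 0)" and fr: "frame (Suc k) s s'"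
      unfolding I_def by blast
    note s' = I_regs[OF fr]
    let ?s1 = "s'(12 + 3 * k := ?P * - t)"
    let ?out = "out @ encode_terms (?done 0)"
    have t: "\<bar>- t\<bar> \<le> X" using t_bound by simp
    have b1: "bdd ?s1" using \<open>bdd s'\<close> prod[OF t] by (intro bdd_upd) auto
    have fr1: "frame (Suc k) s ?s1"
      using fr unfolding frame_def by auto
    have pre: "pre k ls g ?s1"
      unfolding pre_def using I_regs[OF fr1] b1 prod[OF t] s Suc.prems(1) by auto
    have P1: "?s1 (12 + 3 * k) = ?P * - t" by simp
    have thr1: "\<bar>?s1 6\<bar> + const_abs_sum ?last \<le> M"
      using I_budget[of s' 0, OF thr] by simp
    have gen: "wp (gen k ls) (gen_time p n k) (post k ?last ?s1 inp ?out) (?s1, inp, ?out)"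
      by (rule Suc.IH[OF _ pre, unfolded P1]) (use thr1 Suc.prems(1) in simp_all)
    have last: "post (Suc k) ?ts s inp out \<tau>" if "post k ?last ?s1 inp ?out \<tau>" for \<tau>
      using that fr1 thr unfolding post_def ts frame_def by auto
    have e1: "s'(dest_addr s' (To_Reg (12 + 3 * k)) := arith Times (operand_val s' (Reg (15 + 3 * k))) (operand_val s' (Reg 5))) = ?s1"
      using s' by simp
    show ?thesis
      unfolding \<tau>
    proof (rule wp_Seq, rule wp_Arith[OF \<open>bdd s'\<close>])
      show "wp (gen k ls) (gen_time p n k) (post (Suc k) ?ts s inp out)
        (s'(dest_addr s' (To_Reg (12 + 3 * k)) := arith Times (operand_val s' (Reg (15 + 3 * k))) (operand_val s' (Reg 5))), inp, ?out)"
        unfolding e1 by (rule wp_mono[OF gen]) (use last in auto)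
    qed (use k s' prod[OF t] in auto)
  qed
  have "bdd s" using s by blast
  let ?s0 = "s(10 + 3 * k := int n)"
  have e0: "s(dest_addr s (To_Reg (10 + 3 * k)) := arith Plus (operand_val s (Reg 2)) (operand_val s (Const 0))) = ?s0"
    using s by simp
  have n: "int n \<le> M" using data_upper by linarith
  have "bdd ?s0" using \<open>bdd s\<close> n by (intro bdd_upd) auto
  then have "I n (?s0, inp, out)"
    unfolding I_def by (auto simp: frame_def)
  have loop: "wp (While_Pos (Reg (10 + 3 * k)) ?body)
      (n * ((1 + (1 + (1 + (gen_time p n k + 1)))) + 1) + 1) (I 0) (?s0, inp, out)"
  proof (rule wp_countdown[where I = I and n = n])
    show "operand_val u (Reg (10 + 3 * k)) = int i \<and> bdd u" if "I i (u, inp', out')" for i u inp' out'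
      using that by (auto simp: I_def)
    show "op_ok (Reg (10 + 3 * k))" using k by simp
  qed (fact body \<open>I n _\<close>)+
  show ?case
    unfolding gen.simps gen_time.simps
  proof (rule wp_Seq, rule wp_Arith[OF \<open>bdd s\<close>], goal_cases)
    \<comment> \<open>The other goals are the side conditions of \<open>wp_Arith\<close>; this one
      is the rest of the program.\<close>
    case 5
    show ?case
      unfolding e0 by (rule wp_Seq, rule wp_mono[OF loop order.refl], rule final)
  qed (use k s n M_pos in auto)
qed

end

section \<open>The program around the expansion: input, powers, rows\<close>

definition read_loop :: com where
  "read_loop = Seq (Read (To_Ind 3))
     (Seq (Arith (To_Reg 3) Plus (Reg 3) (Const 1)) (Arith (To_Reg 4) Minus (Reg 4) (Const 1)))"

text \<open>While reading, register 3 is the next free address and register 4 the number of entries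
  left. The number of variables is already written here, being the first output.\<close>

definition read_prog :: "nat \<Rightarrow> com" where
  "read_prog p = Seq (Read (To_Reg 1)) (Seq (Read (To_Reg 2)) (Seq (Write (Reg 2))
     (Seq (Arith (To_Reg 4) Times (Reg 1) (Reg 2)) (Seq (Arith (To_Reg 4) Plus (Reg 4) (Reg 1))
       (Seq (Arith (To_Reg 3) Plus (Const (int (13 + 3 * p))) (Const 0))
         (While_Pos (Reg 4) read_loop))))))"

definition power_prog :: "nat \<Rightarrow> nat \<Rightarrow> int \<Rightarrow> com" where
  "power_prog p r c = Seq (Read (To_Reg 9)) (Seq (Arith (To_Reg r) Plus (Const c) (Const 0))
     (seqs (replicate p (Arith (To_Reg r) Times (Reg r) (Reg 9)))))"

text \<open>The threshold starts at \<open>- (a ^ p)\<close> and the product of level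
  \<open>p\<close> at \<open>b ^ p\<close>. Registers 3 and 4 agree at first, since the target
  directly follows the last row.\<close>

definition setup_prog :: "nat \<Rightarrow> com" where
  "setup_prog p = Seq (power_prog p 6 (- 1)) (Seq (power_prog p (12 + 3 * p) 1)
     (Seq (Arith (To_Reg 3) Times (Reg 1) (Reg 2))
       (Seq (Arith (To_Reg 3) Plus (Reg 3) (Const (int (12 + 3 * p))))
         (Arith (To_Reg 4) Plus (Reg 3) (Const 0)))))"

text \<open>Rows are handled from the last to the first, so register 3 is lowered before use, and
  register 1 is the row index plus one, matching the address preceding the target.\<close>

definition row_prog :: "nat \<Rightarrow> com" where
  "row_prog p = Seq (Arith (To_Reg 3) Minus (Reg 3) (Reg 2))
     (Seq (Arith (To_Reg 8) Plus (Reg 4) (Reg 1))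
       (Seq (Arith (To_Reg 5) Minus (Const 0) (Ind 8))
         (Seq (gen p []) (Arith (To_Reg 1) Minus (Reg 1) (Const 1)))))"

definition reduction_prog :: "nat \<Rightarrow> com" where
  "reduction_prog p = Seq (read_prog p) (Seq (setup_prog p)
     (Seq (While_Pos (Reg 1) (row_prog p)) (Write (Reg 6))))"

definition reduction_time :: "nat \<Rightarrow> nat \<Rightarrow> nat \<Rightarrow> nat" where
  "reduction_time p m n = (1 + (1 + (1 + (1 + (1 + (1 + ((m * n + m) * ((1 + (1 + 1)) + 1) + 1))))))) +
     (((1 + (1 + (p + 1))) + ((1 + (1 + (p + 1))) + (1 + (1 + 1)))) +
     ((m * ((1 + (1 + (1 + (gen_time p n p + 1)))) + 1) + 1) + 1))"

section \<open>Correctness of the whole program\<close>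

locale reduction_run = machine +
  fixes p m n :: nat and data :: "int list" and a b X :: int
  assumes len: "length data = m * n + m"
    and addresses: "int (13 + 3 * p + length data) \<le> M"
    and n_bound: "int n \<le> M"
    and X: "1 \<le> X" "X \<le> M" "X ^ (2 * p) \<le> M"
    and data_bound: "\<And>x. x \<in> set data \<Longrightarrow> \<bar>x\<bar> \<le> X"
    and ab_bound: "\<bar>a\<bar> \<le> X" "\<bar>b\<bar> \<le> X"
    and const_bound: "X ^ p + const_abs_sum (all_terms p m n (\<lambda>i j. data ! (i * n + j))
      (\<lambda>i. data ! (m * n + i)) (b ^ p)) \<le> M"
begin

abbreviation "B i j \<equiv> data ! (i * n + j)"
abbreviation "t i \<equiv> data ! (m * n + i)"

definition loaded :: "mem \<Rightarrow> bool" where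
  "loaded s \<longleftrightarrow> bdd s \<and> s 2 = int n \<and> (\<forall>j < length data. s (13 + 3 * p + j) = data ! j)"

lemma regs: "int (13 + 3 * p) \<le> M" and m_bound: "int m \<le> M" and mn_bound: "int (m * n + m) \<le> M"
  using addresses len by linarith+

lemma numeral_le_M [simp]: "numeral w \<le> (13 :: int) \<Longrightarrow> numeral w \<le> M"
  and one_le_M [simp]: "1 \<le> M" and zero_le_M [simp]: "0 \<le> M"
  using regs M_pos by linarith+

lemma read_correct:
  "wp (read_prog p) (1 + (1 + (1 + (1 + (1 + (1 + (length data * ((1 + (1 + 1)) + 1) + 1)))))))
     (\<lambda>\<tau>. \<exists>s. \<tau> = (s, [a, b], [int n]) \<and> loaded s \<and> s 1 = int m)
     (\<lambda>_. 0, [int m, int n] @ data @ [a, b], [])"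
proof -
  let ?N = "length data"
  \<comment> \<open>Here \<open>i\<close> counts the entries still to be read.\<close>
  define I where "I i \<tau> \<longleftrightarrow> (\<exists>s. \<tau> = (s, drop (?N - i) data @ [a, b], [int n]) \<and> bdd s \<and> i \<le> ?N \<and>
    s 4 = int i \<and> s 3 = int (13 + 3 * p + (?N - i)) \<and> s 1 = int m \<and> s 2 = int n \<and>
    (\<forall>j < ?N - i. s (13 + 3 * p + j) = data ! j))" for i \<tau>
  have body: "wp read_loop (1 + (1 + 1)) (I i) \<sigma>" if "i < ?N" "I (Suc i) \<sigma>" for i \<sigma>
  proof -
    let ?j = "?N - Suc i"
    from that obtain s where \<sigma>: "\<sigma> = (s, drop ?j data @ [a, b], [int n])" and "bdd s"
      and s: "s 4 = int (Suc i)" "s 3 = int (13 + 3 * p + ?j)" "s 1 = int m" "s 2 = int n"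
      and mem: "\<And>j. j < ?j \<Longrightarrow> s (13 + 3 * p + j) = data ! j"
      unfolding I_def by blast
    have j: "?j < ?N" "?N - i = Suc ?j" using that(1) by auto
    have drop: "drop ?j data = data ! ?j # drop (Suc ?j) data"
      using j(1) by (simp add: Cons_nth_drop_Suc)
    have bnds: "\<bar>data ! ?j\<bar> \<le> M" "int (13 + 3 * p + Suc ?j) \<le> M" "int (Suc i) \<le> M"
      using data_bound[OF nth_mem[OF j(1)]] X addresses j that(1) by linarith+
    let ?s1 = "s(13 + 3 * p + ?j := data ! ?j)"
    let ?s3 = "?s1(3 := int (13 + 3 * p + Suc ?j), 4 := int i)"
    have "bdd ?s1" using \<open>bdd s\<close> bnds(1) by (rule bdd_upd)
    have fin: "I i (?s3, drop (Suc ?j) data @ [a, b], [int n])" if "bdd ?s3"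
      unfolding I_def j using that s mem \<open>i < ?N\<close> by (auto simp: less_Suc_eq)
    show ?thesis
      unfolding \<sigma> drop read_loop_def append_Cons
    proof (rule wp_Seq, rule wp_Read[OF \<open>bdd s\<close>])
      have e: "s(dest_addr s (To_Ind 3) := data ! ?j) = ?s1"
        by (simp only: dest_addr.simps s nat_int)
      show "wp (Seq (Arith (To_Reg 3) Plus (Reg 3) (Const 1)) (Arith (To_Reg 4) Minus (Reg 4) (Const 1)))
        (1 + 1) (I i) (s(dest_addr s (To_Ind 3) := data ! ?j), drop (Suc ?j) data @ [a, b], [int n])"
        unfolding e
      proof (rule wp_Seq, rule wp_Arith[OF \<open>bdd ?s1\<close>], goal_cases)
        case 5
        have e3: "?s1(dest_addr ?s1 (To_Reg 3) := arith Plus (operand_val ?s1 (Reg 3)) (operand_val ?s1 (Const 1))) =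
          ?s1(3 := int (13 + 3 * p + Suc ?j))"
          using s by (simp add: ac_simps)
        have e4: "s'(dest_addr s' (To_Reg 4) := arith Minus (operand_val s' (Reg 4)) (operand_val s' (Const 1))) = s'(4 := int i)"
          if "s' 4 = int (Suc i)" for s'
          using that by simp
        show ?case
          unfolding e3
        proof (rule wp_Arith, goal_cases)
          case 1
          show ?case using bnds(2) by (intro bdd_upd[OF \<open>bdd ?s1\<close>]) auto
        next
          case 6
          then show ?case using fin e4[of "?s1(3 := int (13 + 3 * p + Suc ?j))"] s by simp
        qed (use s bnds in auto)
      qed (use s bnds in auto)
    qed (use bnds(1) in auto)
  qed
  \<comment> \<open>The memory on entering the loop, with the updates in program order.\<close>
  let ?s = "(\<lambda>_. 0)(1 := int m, 2 := int n, 4 := int m * int n + int m, 3 := int (13 + 3 * p)) :: mem"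
  have "bdd ?s"
    using mn_bound m_bound n_bound regs M_pos unfolding bdd_def by auto
  have init: "I ?N (?s, data @ [a, b], [int n])"
    unfolding I_def using len \<open>bdd ?s\<close> by auto
  have loop: "wp (While_Pos (Reg 4) read_loop) (?N * ((1 + (1 + 1)) + 1) + 1) (I 0) (?s, data @ [a, b], [int n])"
  proof (rule wp_countdown[where I = I and n = ?N])
    show "operand_val u (Reg 4) = int i \<and> bdd u" if "I i (u, inp', out')" for i u inp' out'
      using that by (auto simp: I_def)
    show "op_ok (Reg 4)" using regs by simp
  qed (fact body init)+
  have post: "\<exists>s. \<tau> = (s, [a, b], [int n]) \<and> loaded s \<and> s 1 = int m" if "I 0 \<tau>" for \<tau>
    using that unfolding I_def loaded_def by auto
  have zero: "bdd (\<lambda>_. 0)" using M_pos by (simp add: bdd_def)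
  have final: "wp (While_Pos (Reg 4) read_loop) (?N * ((1 + (1 + 1)) + 1) + 1)
      (\<lambda>\<tau>. \<exists>s. \<tau> = (s, [a, b], [int n]) \<and> loaded s \<and> s 1 = int m) (?s, data @ [a, b], [int n])"
    by (rule wp_mono[OF loop order.refl post])
  have mn: "int m * int n \<le> M" "int m * int n + int m \<le> M"
    using mn_bound by simp_all
  show ?thesis
    unfolding read_prog_def append_Cons
    by (intro wp_Seq wp_Read[OF zero] wp_Read wp_Write wp_Arith)
      (simp_all add: m_bound n_bound regs[simplified] mn final[simplified])
qed

lemma power_correct:
  assumes "bdd s" "int r \<le> M" "r \<noteq> 9" "\<bar>x\<bar> \<le> X" "\<bar>c\<bar> = 1"
    and "bdd (s(9 := x, r := c * x ^ p)) \<Longrightarrow> Q (s(9 := x, r := c * x ^ p), inp, out)"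
  shows "wp (power_prog p r c) (1 + (1 + (p + 1))) Q (s, x # inp, out)"
proof -
  have "X ^ p \<le> X ^ (2 * p)"
    using X by (intro power_increasing) auto
  then have Xp: "X ^ p \<le> M" using X by linarith
  have e: "s(9 := x, r := c, r := (s(9 := x, r := c)) r * (s(9 := x, r := c)) 9 ^ p) = s(9 := x, r := c * x ^ p)"
    using \<open>r \<noteq> 9\<close> by simp
  have power: "wp (seqs (replicate p (Arith (To_Reg r) Times (Reg r) (Reg 9)))) (p + 1) Q (s(9 := x, r := c), inp, out)"
    if "bdd (s(9 := x, r := c))"
    by (rule wp_power[OF that _ _ _ _ X(1)]) (use assms Xp in \<open>simp_all add: e del: fun_upd_apply\<close>, simp_all)
  show ?thesis
    unfolding power_prog_def
    by (intro wp_Seq wp_Read wp_Arith) (use assms X power in auto)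
qed

lemma setup_correct:
  assumes "loaded s" "s 1 = int m"
  shows "wp (setup_prog p) ((1 + (1 + (p + 1))) + ((1 + (1 + (p + 1))) + (1 + (1 + 1))))
     (\<lambda>\<tau>. \<exists>s. \<tau> = (s, [], out) \<and> loaded s \<and> s 1 = int m \<and> s 3 = int (12 + 3 * p + m * n) \<and>
        s 4 = int (12 + 3 * p + m * n) \<and> s 6 = - (a ^ p) \<and> s (12 + 3 * p) = b ^ p)
     (s, [a, b], out)"
  (is "wp _ _ ?Q _")
proof -
  have "bdd s" and s2: "s 2 = int n" and mem: "\<And>j. j < length data \<Longrightarrow> s (13 + 3 * p + j) = data ! j"
    using assms(1) unfolding loaded_def by auto
  \<comment> \<open>The factors \<open>- 1\<close> and \<open>1\<close> are kept to match
    \<open>c * x ^ p\<close> in \<open>power_correct\<close>.\<close>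
  let ?s1 = "s(9 := a, 6 := - 1 * a ^ p)"
  let ?s2 = "?s1(9 := b, 12 + 3 * p := 1 * b ^ p)"
  have idx: "int (12 + 3 * p + m * n) \<le> M" "int (m * n) \<le> M" "int (12 + 3 * p) \<le> M"
    using addresses len by linarith+
  show ?thesis
    unfolding setup_prog_def
  proof (rule wp_Seq, rule power_correct[OF \<open>bdd s\<close>])
    assume "bdd ?s1"
    show "wp (Seq (power_prog p (12 + 3 * p) 1)
       (Seq (Arith (To_Reg 3) Times (Reg 1) (Reg 2))
         (Seq (Arith (To_Reg 3) Plus (Reg 3) (Const (int (12 + 3 * p))))
           (Arith (To_Reg 4) Plus (Reg 3) (Const 0)))))
      ((1 + (1 + (p + 1))) + (1 + (1 + 1))) ?Q (?s1, [b], out)"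
    proof (rule wp_Seq, rule power_correct[OF \<open>bdd ?s1\<close>])
      let ?s3 = "?s2(3 := int (m * n))"
      let ?s4 = "?s2(3 := int (12 + 3 * p + m * n))"
      let ?s5 = "?s4(4 := int (12 + 3 * p + m * n))"
      assume b2: "bdd ?s2"
      have b3: "bdd ?s3" using idx(2) by (intro bdd_upd[OF b2]) simp
      have b4: "bdd ?s4" using idx(1) by (intro bdd_upd[OF b2]) simp
      have "loaded ?s5" if "bdd ?s5"
        using that s2 mem by (simp add: loaded_def)
      then have fin: "?Q (?s5, [], out)" if "bdd ?s5"
        using that assms(2) by simp
      show "wp (Seq (Arith (To_Reg 3) Times (Reg 1) (Reg 2))
         (Seq (Arith (To_Reg 3) Plus (Reg 3) (Const (int (12 + 3 * p))))
           (Arith (To_Reg 4) Plus (Reg 3) (Const 0))))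
        (1 + (1 + 1)) ?Q (?s2, [], out)"
      proof (rule wp_Seq, rule wp_Arith[OF b2], goal_cases)
        case 5
        have e3: "?s2(dest_addr ?s2 (To_Reg 3) := arith Times (operand_val ?s2 (Reg 1)) (operand_val ?s2 (Reg 2))) = ?s3"
          using s2 assms(2) by simp
        show ?case
          unfolding e3
        proof (rule wp_Seq, rule wp_Arith[OF b3], goal_cases)
          case 5
          have e4: "?s3(dest_addr ?s3 (To_Reg 3) := arith Plus (operand_val ?s3 (Reg 3)) (operand_val ?s3 (Const (int (12 + 3 * p))))) = ?s4"
            by (simp add: ac_simps)
          have e5: "?s4(dest_addr ?s4 (To_Reg 4) := arith Plus (operand_val ?s4 (Reg 3)) (operand_val ?s4 (Const 0))) = ?s5"
            by simp
          show ?case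
            unfolding e4 by (rule wp_Arith[OF b4]) (use fin[folded e5] idx(1) in \<open>simp_all del: fun_upd_apply\<close>, simp_all)
        qed (use idx(1,3) in auto)
      qed (use s2 assms(2) idx(2) in auto)
    qed (use ab_bound idx in auto)
  qed (use ab_bound in auto)
qed

lemma rows_correct:
  assumes "loaded s" "s 1 = int m" "s 3 = int (12 + 3 * p + m * n)"
        "s 4 = int (12 + 3 * p + m * n)" "s 6 = - (a ^ p)" "s (12 + 3 * p) = b ^ p"
  shows "wp (While_Pos (Reg 1) (row_prog p)) (m * ((1 + (1 + (1 + (gen_time p n p + 1)))) + 1) + 1)
     (\<lambda>\<tau>. \<exists>s. \<tau> = (s, inp, out @ encode_terms (all_terms p m n B t (b ^ p))) \<and>
        bdd s \<and> s 6 = const_sum (all_terms p m n B t (b ^ p)) - a ^ p)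
     (s, inp, out)"
proof -
  let ?f = "\<lambda>i. terms n (B i) (t i) p (b ^ p) []"
  let ?done = "\<lambda>i. concat (map ?f (rev [i..<m]))"
  let ?todo = "\<lambda>i. concat (map ?f (rev [0..<i]))"
  define I where "I i \<tau> \<longleftrightarrow> (\<exists>s. \<tau> = (s, inp, out @ encode_terms (?done i)) \<and> loaded s \<and> s 1 = int i \<and>
    s 3 = int (12 + 3 * p + i * n) \<and> s 4 = int (12 + 3 * p + m * n) \<and>
    s 6 = const_sum (?done i) - a ^ p \<and> s (12 + 3 * p) = b ^ p)" for i \<tau>
  have a: "\<bar>a ^ p\<bar> \<le> X ^ p"
    using ab_bound by (simp add: power_abs power_mono)
  \<comment> \<open>The product starts at \<open>b ^ p\<close> and receives \<open>p\<close> more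
    factors, which explains the exponent \<open>2 * p\<close> in the locale.\<close>
  have b: "\<bar>b ^ p\<bar> * X ^ p \<le> M"
  proof -
    have "\<bar>b ^ p\<bar> * X ^ p \<le> X ^ p * X ^ p"
      using ab_bound X by (intro mult_right_mono) (auto simp: power_abs power_mono)
    also have "\<dots> = X ^ (2 * p)" by (simp add: mult_2 power_add)
    finally show ?thesis using X by linarith
  qed
  have split_done: "?done i = ?done (Suc i) @ ?f i" if "i < m" for i
    using that by (simp add: upt_conv_Cons)
  have total: "const_abs_sum (?done i) + const_abs_sum (?todo i) = const_abs_sum (?todo m)" if "i \<le> m" for i
  proof -
    have "[0..<m] = [0..<i] @ [i..<m]" using that by (metis le_add_diff_inverse upt_add_eq_append zero_le)
    then show ?thesis by simp
  qed
  have body: "wp (row_prog p) (1 + (1 + (1 + (gen_time p n p + 1)))) (I i) \<sigma>" if "i < m" "I (Suc i) \<sigma>" for i \<sigma>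
  proof -
    from that obtain s where \<sigma>: "\<sigma> = (s, inp, out @ encode_terms (?done (Suc i)))" and "loaded s"
      and s: "s 1 = int (Suc i)" "s 3 = int (12 + 3 * p + Suc i * n)" "s 4 = int (12 + 3 * p + m * n)"
        "s 6 = const_sum (?done (Suc i)) - a ^ p" "s (12 + 3 * p) = b ^ p"
      unfolding I_def by blast
    have "bdd s" and "s 2 = int n" and mem: "\<And>j. j < length data \<Longrightarrow> s (13 + 3 * p + j) = data ! j"
      using \<open>loaded s\<close> unfolding loaded_def by auto
    have "Suc i * n \<le> m * n" using that(1) by (intro mult_le_mono1) simp
    then have idx: "i * n + n \<le> m * n" by simp
    have lt: "i * n + j < length data" if "j < n" for j
      using idx that unfolding len by linarith
    have mem': "s (12 + 3 * p + i * n + j + 1) = B i j" if "j < n" for j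
      using mem[OF lt[OF that]] by (simp add: ac_simps)
    have lt': "m * n + i < length data"
      using that(1) len by simp
    let ?s1 = "s(3 := int (12 + 3 * p + i * n))"
    let ?s2 = "?s1(8 := int (13 + 3 * p + (m * n + i)))"
    let ?s3 = "?s2(5 := - t i)"
    let ?out = "out @ encode_terms (?done (Suc i))"
    have bnds: "int (12 + 3 * p + i * n) \<le> M" "int (13 + 3 * p + (m * n + i)) \<le> M"
        "int (12 + 3 * p + i * n + n) \<le> M"
      using addresses len idx lt' by linarith+
    have ti: "\<bar>t i\<bar> \<le> X" using data_bound lt' by simp
    have b1: "bdd ?s1" using bnds by (intro bdd_upd[OF \<open>bdd s\<close>]) auto
    have b2: "bdd ?s2" using bnds by (intro bdd_upd[OF b1]) auto
    have b3: "bdd ?s3" using ti X by (intro bdd_upd[OF b2]) auto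
    interpret row_expansion M p n "12 + 3 * p + i * n" "B i" "t i" X
    proof
      show "int (12 + 3 * p + i * n + n) \<le> M" by (fact bnds)
    qed (use regs X data_bound lt ti in auto)
    have pre: "pre p [] (\<lambda>_. 0) ?s3"
      unfolding pre_def using b3 \<open>s 2 = int n\<close> b s mem' by auto
    have P3: "?s3 (12 + 3 * p) = b ^ p" using s by simp
    \<comment> \<open>The summand \<open>X ^ p\<close> in \<open>const_bound\<close> pays for the
      initial threshold, the rest for the rows done and the current one.\<close>
    have thr3: "\<bar>?s3 6\<bar> + const_abs_sum (?f i) \<le> M"
    proof -
      have "const_abs_sum (?done (Suc i)) + (const_abs_sum (?f i) + const_abs_sum (?todo i)) = const_abs_sum (?todo m)"
        using total[of "Suc i"] that(1) by simp
      then show ?thesis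
        using const_bound a abs_const_sum_le[of "?done (Suc i)"] const_abs_sum_nonneg[of "?todo i"] s(4)
        unfolding all_terms_def by simp
    qed
    have gen: "wp (gen p []) (gen_time p n p) (post p (?f i) ?s3 inp ?out) (?s3, inp, ?out)"
      by (rule gen_correct[OF _ pre, unfolded P3 list.map]) (use thr3 in simp_all)
    have last: "wp (Arith (To_Reg 1) Minus (Reg 1) (Const 1)) 1 (I i) \<tau>"
      if "post p (?f i) ?s3 inp ?out \<tau>" for \<tau>
    proof -
      from that obtain u where \<tau>: "\<tau> = (u, inp, ?out @ encode_terms (?f i))" and "bdd u"
        and u6: "u 6 = s 6 + const_sum (?f i)" and fru: "frame p ?s3 u"
        unfolding post_def by auto
      have u: "u 1 = int (Suc i)" "u 2 = int n" "u 3 = int (12 + 3 * p + i * n)"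
          "u 4 = int (12 + 3 * p + m * n)" "u (12 + 3 * p) = b ^ p"
          "\<And>j. j < length data \<Longrightarrow> u (13 + 3 * p + j) = data ! j"
        using fru s \<open>s 2 = int n\<close> mem unfolding frame_def by auto
      show ?thesis
        unfolding \<tau> using \<open>bdd u\<close> M_pos u u6 s split_done[OF \<open>i < m\<close>] m_bound \<open>i < m\<close>
        by (intro wp_Arith) (auto simp: I_def loaded_def)
    qed
    have ind: "operand_val ?s2 (Ind 8) = t i"
    proof -
      have "?s2 8 = int (13 + 3 * p + (m * n + i))" by simp
      then have "operand_val ?s2 (Ind 8) = ?s2 (13 + 3 * p + (m * n + i))"
        by (simp only: operand_val.simps nat_int)
      then show ?thesis
        using mem[OF lt'] by simp
    qed
    show ?thesis
      unfolding \<sigma> row_prog_def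
    proof (rule wp_Seq, rule wp_Arith[OF \<open>bdd s\<close>], goal_cases)
      case 5
      have e1: "s(dest_addr s (To_Reg 3) := arith Minus (operand_val s (Reg 3)) (operand_val s (Reg 2))) = ?s1"
        using s \<open>s 2 = int n\<close> by (simp add: ac_simps)
      show ?case
        unfolding e1
      proof (rule wp_Seq, rule wp_Arith[OF b1], goal_cases)
        case 5
        have e2: "?s1(dest_addr ?s1 (To_Reg 8) := arith Plus (operand_val ?s1 (Reg 4)) (operand_val ?s1 (Reg 1))) = ?s2"
          using s by (simp add: ac_simps)
        show ?case
          unfolding e2
        proof (rule wp_Seq, rule wp_Arith[OF b2], goal_cases)
          case 5
          have e3: "?s2(dest_addr ?s2 (To_Reg 5) := arith Minus (operand_val ?s2 (Const 0)) (operand_val ?s2 (Ind 8))) = ?s3"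
            unfolding arith.simps dest_addr.simps ind by simp
          show ?case
            unfolding e3 by (rule wp_Seq, rule wp_mono[OF gen]) (use last in auto)
        qed (use ti X ind in \<open>auto simp del: operand_val.simps(3)\<close>)
      qed (use s bnds in auto)
    qed (use s \<open>s 2 = int n\<close> bnds in auto)
  qed
  have "I m (s, inp, out)"
    using assms unfolding I_def by auto
  have loop: "wp (While_Pos (Reg 1) (row_prog p)) (m * ((1 + (1 + (1 + (gen_time p n p + 1)))) + 1) + 1) (I 0) (s, inp, out)"
  proof (rule wp_countdown[where I = I and n = m])
    show "operand_val u (Reg 1) = int i \<and> bdd u" if "I i (u, inp', out')" for i u inp' out'
      using that by (auto simp: I_def loaded_def)
    show "op_ok (Reg 1)" using regs by simp
  qed (fact body \<open>I m _\<close>)+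
  show ?thesis
    by (rule wp_mono[OF loop order.refl]) (auto simp: I_def loaded_def all_terms_def)
qed

lemma reduction_prog_correct:
  "wp (reduction_prog p) (reduction_time p m n)
     (\<lambda>(s, inp, out). out = int n # encode_terms (all_terms p m n B t (b ^ p)) @
        [const_sum (all_terms p m n B t (b ^ p)) - a ^ p])
     (\<lambda>_. 0, [int m, int n] @ data @ [a, b], [])"
  unfolding reduction_prog_def reduction_time_def len[symmetric]
proof (rule wp_Seq, rule wp_mono[OF read_correct order.refl], elim exE conjE, hypsubst,
    rule wp_Seq, rule wp_mono[OF setup_correct order.refl], goal_cases)
  case (3 s \<tau>)
  then show ?case
    by (elim exE conjE, hypsubst, intro wp_Seq, intro wp_mono[OF rows_correct order.refl])
      (use regs in \<open>auto intro: wp_Write[unfolded One_nat_def]\<close>)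
qed

end

section \<open>Running time\<close>

text \<open>Closure under sums and products avoids writing down an explicit polynomial.\<close>

definition poly_bounded :: "(nat \<Rightarrow> nat) \<Rightarrow> bool" where
  "poly_bounded f \<longleftrightarrow> (\<exists>q :: nat poly. \<forall>x. f x \<le> poly q x)"

lemma poly_bounded_const: "poly_bounded (\<lambda>_. c)"
  unfolding poly_bounded_def by (rule exI[of _ "[:c:]"]) simp

lemma poly_bounded_id: "poly_bounded (\<lambda>x. x)"
  unfolding poly_bounded_def by (rule exI[of _ "[:0, 1:]"]) simp

lemma poly_bounded_add: "poly_bounded f \<Longrightarrow> poly_bounded g \<Longrightarrow> poly_bounded (\<lambda>x. f x + g x)"
  unfolding poly_bounded_def by (metis add_mono poly_add)

lemma poly_bounded_mult: "poly_bounded f \<Longrightarrow> poly_bounded g \<Longrightarrow> poly_bounded (\<lambda>x. f x * g x)"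
  unfolding poly_bounded_def by (metis mult_le_mono poly_mult)

lemmas poly_bounded_intros =
  poly_bounded_const poly_bounded_id poly_bounded_add poly_bounded_mult

lemma poly_bounded_gen_time: "poly_bounded (\<lambda>L. gen_time p L k)"
  by (induction k) (auto simp only: gen_time.simps intro!: poly_bounded_intros)

lemma poly_bounded_reduction_time: "poly_bounded (\<lambda>L. reduction_time p L L)"
  unfolding reduction_time_def by (intro poly_bounded_intros poly_bounded_gen_time)

lemma gen_time_mono: "n \<le> n' \<Longrightarrow> gen_time p n k \<le> gen_time p n' k"
proof (induction k)
  case (Suc k)
  then show ?case
    unfolding gen_time.simps by (intro add_mono mult_le_mono order.refl) auto
qed simp

text \<open>The number of entries bounds \<open>n\<close> only if there is a row; without rows the
  running time does not depend on \<open>n\<close>.\<close>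

lemma reduction_time_le:
  assumes "m * n + m \<le> L"
  shows "reduction_time p m n \<le> reduction_time p L L"
proof (cases "m = 0")
  case False
  then have "n \<le> L" "m \<le> L"
    using assms by (metis add_leD1 le_trans mult_le_mono1 mult_1 less_one not_le, linarith)
  then show ?thesis
    unfolding reduction_time_def by (intro add_mono mult_le_mono order.refl gen_time_mono)
qed (simp add: reduction_time_def)

section \<open>Row-major addressing and size bounds from the input length\<close>

lemma nth_concat_map:
  assumes "i < m" "j < n" "\<And>i. length (f i) = n"
  shows "concat (map f [0..<m]) ! (i * n + j) = f i ! j"
  using assms(1)
proof (induction m)
  case (Suc m)
  have len: "length (concat (map f [0..<m])) = m * n"
    using assms(3) by (simp add: length_concat o_def sum_list_triv)
  show ?case
  proof (cases "i < m")
    case True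
    then have "Suc i * n \<le> m * n" by (intro mult_le_mono1) simp
    then have "i * n + j < m * n" using \<open>j < n\<close> by simp
    then show ?thesis using Suc.IH[OF True] len by (simp add: nth_append)
  next
    case False
    then have "i = m" using Suc.prems by simp
    then show ?thesis using len by (simp add: nth_append)
  qed
qed simp

lemma all_terms_cong:
  assumes "\<And>i j. i < m \<Longrightarrow> j < n \<Longrightarrow> B i j = B' i j" "\<And>i. i < m \<Longrightarrow> t i = t' i"
  shows "all_terms p m n B t P = all_terms p m n B' t' P"
  unfolding all_terms_def
  using assms by (auto intro!: arg_cong[where f = concat] map_cong terms_cong)

lemma length_le_input_len: "length xs \<le> input_len xs"
  by (induction xs) (auto simp: input_len_def int_len_def)

lemma abs_le_input_len: "x \<in> set xs \<Longrightarrow> \<bar>x\<bar> < 2 ^ input_len xs"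
proof -
  assume "x \<in> set xs"
  then have "int_len x \<le> input_len xs"
    unfolding input_len_def by (intro member_le_sum_list) auto
  then have "(2 :: int) ^ int_len x \<le> 2 ^ input_len xs"
    by (intro power_increasing) auto
  with int_len_bound[of x] show ?thesis by linarith
qed

lemma less_two_power: "int k < 2 ^ k"
  using less_exp[of k] by (metis of_nat_less_iff of_nat_numeral of_nat_power)

lemma polytime_reduction:
  "polytime_computable_on {I. valid_cvp I} encode_cvp encode_maxsat (reduction p)"
proof -
  \<comment> \<open>All registers will stay within \<open>2 ^ E L\<close>: the coefficient of
    \<open>L\<close> comes from the bound on the constants, and the second summand leaves room for
    the initial threshold and the addresses.\<close>
  define E where "E L = (3 * p + 1) * L + (4 * p + 20)" for L
  have "poly_bounded (\<lambda>L. reduction_time p L L * (1 + 9 * (E L + 2)))"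
    unfolding E_def by (intro poly_bounded_intros poly_bounded_reduction_time)
  then obtain q where q: "\<And>L. reduction_time p L L * (1 + 9 * (E L + 2)) \<le> poly q L"
    unfolding poly_bounded_def by blast
  have "\<exists>t s inp. exec (reduction_prog p) (\<lambda>_. 0, encode_cvp I, []) t (s, inp, encode_maxsat (reduction p I)) \<and>
      t \<le> poly q (input_len (encode_cvp I))" if "valid_cvp I" for I
  proof -
    define m n where "m = dim_row (basis I)" and "n = dim_col (basis I)"
    obtain a b where ab: "quotient_of (dist_bound I) = (a, b)" by fastforce
    define data where "data = concat (mat_to_list (basis I)) @ list_of_vec (target I)"
    define L where "L = input_len (encode_cvp I)"
    have enc: "encode_cvp I = [int m, int n] @ data @ [a, b]"
      by (simp add: encode_cvp_def m_def n_def data_def ab)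
    have dim: "dim_vec (target I) = m"
      using that by (simp add: valid_cvp_def m_def)
    have len: "length data = m * n + m"
      by (simp add: data_def length_concat_mat_to_list dim m_def n_def)
    have len_L: "m * n + m + 4 \<le> L"
      using length_le_input_len[of "encode_cvp I"] by (simp add: enc len L_def)
    have small: "\<bar>x\<bar> < 2 ^ L" if "x \<in> set (encode_cvp I)" for x
      unfolding L_def using that by (rule abs_le_input_len)
    \<comment> \<open>Strictness of \<open>small\<close> provides the extra one next to
      \<open>n\<close>.\<close>
    have mn_small: "int m \<le> 2 ^ L" "int n + 1 \<le> 2 ^ L"
      using small[of "int m"] small[of "int n"] unfolding enc by (simp_all only: list.set append_Cons insert_iff simp_thms abs_of_nat zless_imp_add1_zle less_imp_le)
    have b_small: "\<bar>b ^ p\<bar> \<le> (2 ^ L) ^ p"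
      unfolding power_abs using small[of b] by (intro power_mono) (auto simp: enc)
    let ?B = "\<lambda>i j. data ! (i * n + j)" and ?t = "\<lambda>i. data ! (m * n + i)"
    have B: "?B i j = basis I $$ (i, j)" and B_mem: "?B i j \<in> set data" if "i < m" "j < n" for i j
    proof -
      have "Suc i * n \<le> m * n" using that by (intro mult_le_mono1) simp
      then have "i * n + j < m * n" using that by simp
      then show "?B i j \<in> set data" using len by (intro nth_mem) simp
      have "?B i j = concat (mat_to_list (basis I)) ! (i * n + j)"
        using \<open>i * n + j < m * n\<close> by (simp add: data_def nth_append length_concat_mat_to_list m_def n_def)
      also have "\<dots> = basis I $$ (i, j)"
        using nth_concat_map[OF that, of "\<lambda>i. map (\<lambda>j. basis I $$ (i, j)) [0..<n]"] that
        by (simp add: m_def n_def mat_to_list_def)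
      finally show "?B i j = basis I $$ (i, j)" .
    qed
    have t: "?t i = target I $ i" and t_mem: "?t i \<in> set data" if "i < m" for i
    proof -
      show "?t i = target I $ i"
        using that dim by (simp add: data_def nth_append length_concat_mat_to_list m_def n_def list_of_vec_index)
      show "?t i \<in> set data" using that len by (intro nth_mem) simp
    qed
    let ?ts = "all_terms p m n ?B ?t (b ^ p)"
    have p_less: "int (p + 1) \<le> 2 ^ p"
      using less_two_power[of p] by linarith
    have "const_abs_sum ?ts \<le> int m * ((int n + 1) ^ p * (\<bar>b ^ p\<bar> * (2 ^ L) ^ p * int (p + 1)))"
      using B_mem t_mem small by (intro const_abs_sum_all_terms) (auto simp: enc intro!: less_imp_le)
    \<comment> \<open>The factors are, in order, the bounds for the rows, the choices per row,
      \<open>b ^ p\<close>, the entries picked, and \<open>p + 1\<close>.\<close>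
    also have "\<dots> \<le> 2 ^ L * ((2 ^ L) ^ p * ((2 ^ L) ^ p * (2 ^ L) ^ p * 2 ^ p))"
      using mn_small b_small p_less
      by (intro mult_mono power_mono) auto
    also have "\<dots> = 2 ^ ((3 * p + 1) * L + p)"
      by (simp add: algebra_simps flip: power_add power_mult)
    finally have abs_sum: "const_abs_sum ?ts \<le> 2 ^ ((3 * p + 1) * L + p)" .
    have "(2 ^ L) ^ p \<le> (2 :: int) ^ ((3 * p + 1) * L + p)"
      unfolding power_mult[symmetric] by (intro power_increasing) (auto simp: algebra_simps)
    with abs_sum have "(2 ^ L) ^ p + const_abs_sum ?ts \<le> 2 ^ ((3 * p + 1) * L + p + 1)"
      by simp
    also have "\<dots> \<le> 2 ^ E L"
      by (intro power_increasing) (auto simp: E_def)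
    finally have const_bound: "(2 ^ L) ^ p + const_abs_sum ?ts \<le> 2 ^ E L" .
    have L_E: "(2 :: int) ^ L \<le> 2 ^ E L" "((2 :: int) ^ L) ^ (2 * p) \<le> 2 ^ E L"
      unfolding power_mult[symmetric] by (intro power_increasing; simp add: E_def algebra_simps)+
    have "13 + 3 * p + length data \<le> E L"
      using len_L by (simp add: len E_def)
    with less_two_power[of "E L"] have addr: "int (13 + 3 * p + length data) \<le> 2 ^ E L"
      by linarith
    interpret reduction_run "2 ^ E L" p m n data a b "2 ^ L"
    proof
      show "\<bar>x\<bar> \<le> 2 ^ L" if "x \<in> set data" for x
        using small[of x] that by (simp add: enc)
      show "\<bar>a\<bar> \<le> 2 ^ L" "\<bar>b\<bar> \<le> 2 ^ L"
        using small[of a] small[of b] by (simp_all add: enc)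
      show "int n \<le> 2 ^ E L" using mn_small L_E by linarith
    qed (use len addr L_E const_bound in auto)
    have ts: "?ts = all_terms p m n (\<lambda>i j. basis I $$ (i, j)) (\<lambda>i. target I $ i) (b ^ p)"
      by (rule all_terms_cong) (simp_all add: B t)
    have out: "int n # encode_terms ?ts @ [const_sum ?ts - a ^ p] = encode_maxsat (reduction p I)"
      unfolding ts by (simp add: encode_maxsat_def reduction_def ab encode_terms_def m_def n_def Let_def)
    obtain t s inp where "exec (reduction_prog p) (\<lambda>_. 0, encode_cvp I, []) t (s, inp, encode_maxsat (reduction p I))"
      and "t \<le> reduction_time p m n * unit_cost"
      using reduction_prog_correct unfolding wp_def enc out by auto
    moreover have "reduction_time p m n * unit_cost \<le> reduction_time p L L * (1 + 9 * (E L + 2))"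
      unfolding unit_cost_def int_len_power
      using len_L by (intro mult_le_mono1 reduction_time_le) simp
    ultimately show ?thesis
      using q[of L] unfolding L_def by (meson le_trans)
  qed
  then show ?thesis
    unfolding polytime_computable_on_def by blast
qed

theorem theorem1p3:
  fixes p :: nat
  assumes "even p" and "p > 0"
  shows "\<exists>f :: cvp_instance \<Rightarrow> maxsat_instance.
           karp_reduction (zero_one_CVP (real p)) (weighted_Max_SAT p) f \<and>
           (\<forall>I \<in> instances (zero_one_CVP (real p)). num_vars (f I) = lattice_rank I)"
proof (intro exI conjI ballI)
  \<comment> \<open>An equivalence for each single assignment settles both directions: existentially
    for YES and universally, after negation, for NO instances.\<close>
  note weight = satisfied_weight_reduction[OF _ assms]
  show "karp_reduction (zero_one_CVP (real p)) (weighted_Max_SAT p) (reduction p)"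
    unfolding karp_reduction_def
  proof (intro conjI ballI)
    have "instances (zero_one_CVP (real p)) \<subseteq> {I. valid_cvp I}"
      by (auto simp: instances_def zero_one_CVP_def)
    then show "polytime_computable_on (instances (zero_one_CVP (real p))) (encode (zero_one_CVP (real p)))
        (encode (weighted_Max_SAT p)) (reduction p)"
      using polytime_reduction[of p] unfolding polytime_computable_on_def
      by (fastforce simp: zero_one_CVP_def weighted_Max_SAT_def)
    show "reduction p I \<in> yes_instances (weighted_Max_SAT p)"
      if "I \<in> yes_instances (zero_one_CVP (real p))" for I
      using that by (auto simp: zero_one_CVP_def weighted_Max_SAT_def binary_vecs_eq valid_reduction weight)
    show "reduction p I \<in> no_instances (weighted_Max_SAT p)"
      if "I \<in> no_instances (zero_one_CVP (real p))" for I
      using that by (auto simp: zero_one_CVP_def weighted_Max_SAT_def binary_vecs_eq valid_reduction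
          weight simp flip: not_le)
  qed
qed (auto simp: reduction_def lattice_rank_def Let_def split: prod.split)

end
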